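(* If a graph $G$ is not chordal, then for every labeling of its vertices by $1,\ldots,n$ and every initial elimination forest $F_0$ for $G$, Algorithm R terminates before visiting all elimination forests for $G$.
   Context: A graph is chordal if every induced cycle has length three. An elimination tree for a connected graph $G$ is a rooted tree on its vertex set consisting of a root $x$ whose children are the roots of elimination trees for the components of $G-x$ (unordered). An elimination forest is one elimination tree per component. Rotation of a tree edge $\{i,j\}$, where $i$ is the parent of $j$: let $H$ be the subgraph induced by the subtree rooted at $i$. Then $j$ takes $i$'s place (child of $i$'s former parent, or root), $i$ becomes a child of $j$, subtrees of $i$ stay with $i$, and each subtree $S$ of $j$ stays with $j$ unless $S$ lies in the same component of $H-j$ as $i$, in which case it moves to $i$. Up-rotation of $j$: rotate the edge to its parent $i<j$. Down-rotation of $j$: rotate an edge to a child $i<j$. Algorithm R on $G=([n],E)$ with initial forest $F_0$: visit $F_0$. Then repeatedly, in the last visited forest, let $j$ be the largest vertex admitting an up- or down-rotation producing an unvisited forest. Terminate if no such $j$ exists, or if more than one edge $\{i,j\}$ with $i<j$ produces an unvisited forest. Otherwise perform that rotation, visit the result, and continue. *)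

theory Defs
  imports Main
begin

definition simple_graph :: "'a set \<Rightarrow> 'a set set \<Rightarrow> bool" where
  "simple_graph V E \<longleftrightarrow> finite V \<and> (\<forall>e\<in>E. e \<subseteq> V \<and> card e = 2)"

definition induced_cycle :: "'a set \<Rightarrow> 'a set set \<Rightarrow> 'a list \<Rightarrow> bool" where
  "induced_cycle V E xs \<longleftrightarrow> length xs \<ge> 3 \<and> distinct xs \<and> set xs \<subseteq> V \<and>
     (\<forall>a<length xs. \<forall>b<length xs. {xs ! a, xs ! b} \<in> E \<longleftrightarrow>
        b = Suc a mod length xs \<or> a = Suc b mod length xs)"

definition chordal :: "'a set \<Rightarrow> 'a set set \<Rightarrow> bool" where
  "chordal V E \<longleftrightarrow> (\<forall>xs. induced_cycle V E xs \<longrightarrow> length xs = 3)"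

definition induced_adj :: "'a set set \<Rightarrow> 'a set \<Rightarrow> 'a rel" where
  "induced_adj E U = {(u, v). u \<in> U \<and> v \<in> U \<and> {u, v} \<in> E}"

definition component :: "'a set set \<Rightarrow> 'a set \<Rightarrow> 'a \<Rightarrow> 'a set" where
  "component E U u = (induced_adj E U)\<^sup>* `` {u}"

definition components :: "'a set set \<Rightarrow> 'a set \<Rightarrow> 'a set set" where
  "components E U = component E U ` U"

definition connected_on :: "'a set set \<Rightarrow> 'a set \<Rightarrow> bool" where
  "connected_on E U \<longleftrightarrow> U \<noteq> {} \<and> (\<forall>u\<in>U. \<forall>v\<in>U. (u, v) \<in> (induced_adj E U)\<^sup>*)"

text \<open>
  A rooted forest on a fixed vertex set is represented by its set of arcs
  \<open>(parent, child)\<close>, so that equality of arc sets is equality of unordered rooted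
  forests. The predicate \<open>elim_tree E U x T\<close> says that \<open>T\<close> is an elimination tree with
  root \<open>x\<close> for the subgraph induced by \<open>U\<close>; the functions \<open>r\<close> and \<open>S\<close> choose, for
  each component, the root and the arcs of an elimination tree.
\<close>

inductive elim_tree :: "'a set set \<Rightarrow> 'a set \<Rightarrow> 'a \<Rightarrow> 'a rel \<Rightarrow> bool" for E :: "'a set set" where
  elim_treeI: "connected_on E U \<Longrightarrow> x \<in> U \<Longrightarrow>
    (\<And>C. C \<in> components E (U - {x}) \<Longrightarrow> elim_tree E C (r C) (S C)) \<Longrightarrow>
    elim_tree E U x (\<Union>C\<in>components E (U - {x}). insert (x, r C) (S C))"

definition elim_forest :: "'a set \<Rightarrow> 'a set set \<Rightarrow> 'a rel \<Rightarrow> bool" where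
  "elim_forest V E F \<longleftrightarrow> (\<exists>S. (\<forall>C\<in>components E V. \<exists>x. elim_tree E C x (S C)) \<and>
     F = (\<Union>C\<in>components E V. S C))"

definition subtree :: "'a rel \<Rightarrow> 'a \<Rightarrow> 'a set" where
  "subtree F i = F\<^sup>* `` {i}"

text \<open>
  The children of \<open>j\<close> whose subtrees move from \<open>j\<close> to \<open>i\<close> when the arc from \<open>i\<close>
  (parent) to \<open>j\<close> (child) is rotated.
\<close>

definition moved :: "'a set set \<Rightarrow> 'a rel \<Rightarrow> 'a \<Rightarrow> 'a \<Rightarrow> 'a set" where
  "moved E F i j = {k. (j, k) \<in> F \<and> subtree F k \<subseteq> component E (subtree F i - {j}) i}"

definition rotation :: "'a set set \<Rightarrow> 'a rel \<Rightarrow> 'a \<Rightarrow> 'a \<Rightarrow> 'a rel" where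
  "rotation E F i j =
     {(a, b) \<in> F. b \<noteq> i \<and> b \<noteq> j \<and> b \<notin> moved E F i j}
     \<union> {(a, j) | a. (a, i) \<in> F} \<union> {(j, i)} \<union> {(i, k) | k. k \<in> moved E F i j}"

text \<open>
  In the following sets of pairs \<open>(i, F')\<close>, the component \<open>i\<close> identifies the rotated
  edge \<open>{i, j}\<close>, so that counting pairs counts edges, and \<open>F'\<close> is the resulting forest.
\<close>

definition up_rotations :: "nat set set \<Rightarrow> nat rel \<Rightarrow> nat \<Rightarrow> (nat \<times> nat rel) set" where
  "up_rotations E F j = {(i, rotation E F i j) | i. i < j \<and> (i, j) \<in> F}"

definition down_rotations :: "nat set set \<Rightarrow> nat rel \<Rightarrow> nat \<Rightarrow> (nat \<times> nat rel) set" where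
  "down_rotations E F j = {(i, rotation E F j i) | i. i < j \<and> (j, i) \<in> F}"

definition new_rotations :: "nat set set \<Rightarrow> nat rel list \<Rightarrow> nat \<Rightarrow> (nat \<times> nat rel) set" where
  "new_rotations E Fs j =
     {(i, F') \<in> up_rotations E (last Fs) j \<union> down_rotations E (last Fs) j. F' \<notin> set Fs}"

text \<open>
  The forest visited next by Algorithm R, given the list \<open>Fs\<close> of the forests visited so
  far in order of visit; \<open>None\<close> means that the algorithm terminates.
\<close>

definition alg_R_next :: "nat set set \<Rightarrow> nat rel list \<Rightarrow> nat rel option" where
  "alg_R_next E Fs =
     (let J = {j. new_rotations E Fs j \<noteq> {}}; N = new_rotations E Fs (Max J)
      in if J = {} \<or> card N > 1 then None else Some (snd (the_elem N)))"

inductive alg_R_visits :: "nat set set \<Rightarrow> nat rel \<Rightarrow> nat rel list \<Rightarrow> bool"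
  for E :: "nat set set" and F0 :: "nat rel" where
  start: "alg_R_visits E F0 [F0]"
| visit: "alg_R_visits E F0 Fs \<Longrightarrow> alg_R_next E Fs = Some F \<Longrightarrow> alg_R_visits E F0 (Fs @ [F])"

definition alg_R_terminates_with :: "nat set set \<Rightarrow> nat rel \<Rightarrow> nat rel list \<Rightarrow> bool" where
  "alg_R_terminates_with E F0 Fs \<longleftrightarrow> alg_R_visits E F0 Fs \<and> alg_R_next E Fs = None"

end

theory Submission
  imports Defs
begin

text \<open>
  Suppose a run visits all elimination forests, and let \<open>n\<close> be the largest vertex. Two
  forests that differ by a rotation of an edge at \<open>n\<close> must be visited consecutively, because
  the earlier of the two still has an unvisited rotation at the top level. So in every forest
  \<open>n\<close> has at most two incident tree edges. If \<open>n\<close> had two non-adjacent neighbours \<open>a\<close>, \<open>b\<close> and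
  its component a fourth vertex, then some forest would contain \<open>n\<close> with children \<open>a\<close>, \<open>b\<close>
  and a parent; hence \<open>n\<close> is simplicial or its component has at most three vertices, and in
  either case \<open>n\<close> lies on no induced cycle of length at least four. Moving \<open>n\<close> to the root and
  deleting it projects forests of \<open>G\<close> onto forests of \<open>G - n\<close>. The fibres are connected by
  rotations at \<open>n\<close>, so the run visits each fibre contiguously, and collapsing the fibres gives
  a run on \<open>G - n\<close> that visits everything. Induction on the number of vertices finishes the
  proof.
\<close>

section \<open>Connected components\<close>

text \<open>The delicate point is that the collapsed run has to obey the algorithm again. When a
  fibre is left, every new rotation of the projected forest must come from a new rotation of the
  current forest; otherwise the algorithm on \<open>G - n\<close> might move elsewhere or stop at a
  tie. A tree edge of the projection can be missing upstairs for two reasons: \<open>n\<close> sits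
  between its ends, or deleting \<open>n\<close> cuts an intermediate vertex off from one of them.
  The first cannot happen at that moment: all rotations at \<open>n\<close> then lead to visited
  forests, only the preceding forest can be one of these, and so \<open>n\<close> has at most one
  incident tree edge. The second is excluded because deleting a simplicial vertex disconnects no
  subtree, and a component of at most three vertices has no room for the four vertices involved.
  Subtrees rather than arcs are the primary data because a rotation moves many arcs but changes only
  two subtrees, and deleting \<open>n\<close> acts on each subtree separately.\<close>

lemma component_refl [simp]: "u \<in> component E U u"
  by (simp add: component_def)

lemma component_subset: "u \<in> U \<Longrightarrow> component E U u \<subseteq> U"
proof
  fix v assume "u \<in> U" "v \<in> component E U u"
  then have "(u, v) \<in> (induced_adj E U)\<^sup>*" by (simp add: component_def)
  then show "v \<in> U" using \<open>u \<in> U\<close>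
    by (induction rule: rtrancl_induct) (auto simp: induced_adj_def)
qed

lemma component_mono: "U \<subseteq> W \<Longrightarrow> component E U u \<subseteq> component E W u"
proof -
  assume "U \<subseteq> W"
  then have "induced_adj E U \<subseteq> induced_adj E W" by (auto simp: induced_adj_def)
  then have "(induced_adj E U)\<^sup>* \<subseteq> (induced_adj E W)\<^sup>*" by (rule rtrancl_mono)
  then show ?thesis by (auto simp: component_def)
qed

lemma sym_induced_adj: "sym (induced_adj E U)"
  by (auto simp: sym_def induced_adj_def insert_commute)

lemma component_eq:
  assumes "v \<in> component E U u"
  shows "component E U v = component E U u"
proof -
  have "(u, v) \<in> (induced_adj E U)\<^sup>*" using assms by (simp add: component_def)
  moreover then have "(v, u) \<in> (induced_adj E U)\<^sup>*"
    using sym_rtrancl[OF sym_induced_adj] by (metis symE)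
  ultimately show ?thesis unfolding component_def by (auto intro: rtrancl_trans)
qed

lemma component_step:
  "x \<in> component E U u \<Longrightarrow> x \<in> U \<Longrightarrow> y \<in> U \<Longrightarrow> {x, y} \<in> E \<Longrightarrow> y \<in> component E U u"
  unfolding component_def by (auto simp: induced_adj_def intro: rtrancl_into_rtrancl)

text \<open>The usual way below to bound a component from above: exhibit a set that edges inside
  \<open>U\<close> cannot leave.\<close>

lemma component_closed:
  assumes "u \<in> C" and "\<And>x y. x \<in> C \<Longrightarrow> x \<in> U \<Longrightarrow> y \<in> U \<Longrightarrow> {x, y} \<in> E \<Longrightarrow> y \<in> C"
  shows "component E U u \<subseteq> C"
proof
  fix v assume "v \<in> component E U u"
  then have "(u, v) \<in> (induced_adj E U)\<^sup>*" by (simp add: component_def)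
  then show "v \<in> C"
    by (induction rule: rtrancl_induct) (use assms in \<open>auto simp: induced_adj_def\<close>)
qed

text \<open>A path in \<open>U\<close> starting at \<open>u\<close> never leaves the component of
  \<open>u\<close>, so it already runs inside \<open>W\<close>.\<close>

lemma component_absorb:
  assumes "component E U u \<subseteq> W" "W \<subseteq> U"
  shows "component E W u = component E U u"
proof
  show "component E W u \<subseteq> component E U u" using assms(2) by (rule component_mono)
  have "component E U u \<subseteq> component E W u \<inter> component E U u"
  proof (rule component_closed)
    fix x y assume x: "x \<in> component E W u \<inter> component E U u" "x \<in> U" "y \<in> U" "{x, y} \<in> E"
    then have y: "y \<in> component E U u" using component_step by fastforce
    with x have "x \<in> W" "y \<in> W" using assms(1) by auto
    with x have "y \<in> component E W u" using component_step by fastforce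
    with y show "y \<in> component E W u \<inter> component E U u" by simp
  qed simp
  then show "component E U u \<subseteq> component E W u" by simp
qed

text \<open>Merges successive deletions: cutting down to the component of \<open>u\<close> between
  two deletions does not affect the final component, so the deletions can be done in either
  order.\<close>

lemma component_diff_component:
  assumes "u \<in> A" "u \<notin> B"
  shows "component E (component E A u - B) u = component E (A - B) u"
proof -
  have "component E (A - B) u \<subseteq> component E A u" by (rule component_mono) auto
  moreover have "component E (A - B) u \<subseteq> A - B" by (rule component_subset) (use assms in auto)
  moreover have "component E A u \<subseteq> A" by (rule component_subset) fact
  ultimately show ?thesis by (intro component_absorb) auto
qed

lemma component_component: "component E (component E A u) u = component E A u" if "u \<in> A"
  using component_diff_component[of u A "{}"] that by simp

lemma connected_on_component: "connected_on E U \<Longrightarrow> u \<in> U \<Longrightarrow> component E U u = U"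
  using component_subset[of u U E] by (auto simp: connected_on_def component_def)

lemma connected_onI:
  assumes "component E U u = U"
  shows "connected_on E U"
proof -
  have "component E U v = U" if "v \<in> U" for v using component_eq that assms by metis
  then show ?thesis using assms component_refl[of u E U]
    unfolding connected_on_def component_def by blast
qed

lemma components_subset: "C \<in> components E U \<Longrightarrow> C \<subseteq> U"
  unfolding components_def using component_subset by fastforce

lemma components_eq: "C \<in> components E U \<Longrightarrow> u \<in> C \<Longrightarrow> component E U u = C"
  unfolding components_def using component_eq by fastforce

lemma component_in_components: "u \<in> U \<Longrightarrow> component E U u \<in> components E U"
  by (simp add: components_def)

lemma connected_on_components: "C \<in> components E U \<Longrightarrow> connected_on E C"
  unfolding components_def using component_component connected_onI by fastforce

section \<open>Tubings and rotations\<close>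

text \<open>
  An elimination forest is encoded by the map \<open>S\<close> sending each vertex to the vertex set of
  its subtree; the arcs of the forest are the covering pairs of the order \<open>v \<in> S u\<close>.
  The third axiom says that \<open>S u\<close> is a whole component of what is left when the proper
  ancestors of \<open>u\<close> have been removed.
\<close>

definition tubing :: "'a set set \<Rightarrow> 'a set \<Rightarrow> ('a \<Rightarrow> 'a set) \<Rightarrow> bool" where
  "tubing E V S \<longleftrightarrow>
     (\<forall>u\<in>V. u \<in> S u \<and> S u \<subseteq> V \<and> component E (S u) u = S u) \<and>
     (\<forall>u\<in>V. \<forall>v\<in>S u. v \<noteq> u \<longrightarrow> S v \<subseteq> S u - {u}) \<and>
     (\<forall>u\<in>V. \<forall>x\<in>S u. \<forall>y\<in>V. {x, y} \<in> E \<longrightarrow> y \<in> S u \<or> u \<in> S y)"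

definition arcs :: "'a set \<Rightarrow> ('a \<Rightarrow> 'a set) \<Rightarrow> 'a rel" where
  "arcs V S = {(u, v). u \<in> V \<and> v \<in> S u \<and> v \<noteq> u \<and> (\<forall>w\<in>S u. v \<in> S w \<longrightarrow> w = u \<or> w = v)}"

lemma tubingI:
  assumes "\<And>u. u \<in> V \<Longrightarrow> u \<in> S u" "\<And>u. u \<in> V \<Longrightarrow> S u \<subseteq> V"
    and "\<And>u. u \<in> V \<Longrightarrow> component E (S u) u = S u"
    and "\<And>u v. u \<in> V \<Longrightarrow> v \<in> S u \<Longrightarrow> v \<noteq> u \<Longrightarrow> S v \<subseteq> S u - {u}"
    and "\<And>u x y. u \<in> V \<Longrightarrow> x \<in> S u \<Longrightarrow> y \<in> V \<Longrightarrow> {x, y} \<in> E \<Longrightarrow> y \<notin> S u \<Longrightarrow> u \<in> S y"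
  shows "tubing E V S"
  using assms unfolding tubing_def by blast

context
  fixes E :: "'a set set" and V :: "'a set" and S :: "'a \<Rightarrow> 'a set"
  assumes tub: "tubing E V S"
begin

lemma tubing_refl: "u \<in> V \<Longrightarrow> u \<in> S u"
  using tub by (simp add: tubing_def)

lemma tubing_subset: "u \<in> V \<Longrightarrow> S u \<subseteq> V"
  using tub by (simp add: tubing_def)

lemma tubing_connected: "u \<in> V \<Longrightarrow> component E (S u) u = S u"
  using tub by (simp add: tubing_def)

lemma tubing_below: "u \<in> V \<Longrightarrow> v \<in> S u \<Longrightarrow> v \<noteq> u \<Longrightarrow> S v \<subseteq> S u - {u}"
  using tub unfolding tubing_def by blast

lemma tubing_edge:
  "u \<in> V \<Longrightarrow> x \<in> S u \<Longrightarrow> y \<in> V \<Longrightarrow> {x, y} \<in> E \<Longrightarrow> y \<notin> S u \<Longrightarrow> u \<in> S y"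
  using tub unfolding tubing_def by blast

lemma tubing_trans: "u \<in> V \<Longrightarrow> v \<in> S u \<Longrightarrow> S v \<subseteq> S u"
  using tubing_below by blast

lemma tubing_antisym: "u \<in> V \<Longrightarrow> v \<in> S u \<Longrightarrow> u \<in> S v \<Longrightarrow> u = v"
  using tubing_below by blast

text \<open>Walk inside the connected set \<open>S v\<close> from \<open>x\<close>. An edge leaving
  \<open>S u\<close> would end at some \<open>z\<close> with \<open>u\<close> in \<open>S z\<close>,
  hence in \<open>S v\<close>; if that is excluded, the walk stays in \<open>S u\<close> and reaches
  \<open>v\<close> there.\<close>

lemma tubing_chain:
  assumes "u \<in> V" "v \<in> V" "x \<in> S u" "x \<in> S v"
  shows "u \<in> S v \<or> v \<in> S u"
proof (rule ccontr)
  assume *: "\<not> ?thesis"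
  have "component E (S v) x \<subseteq> S u"
  proof (rule component_closed)
    fix y z assume yz: "y \<in> S u" "y \<in> S v" "z \<in> S v" "{y, z} \<in> E"
    show "z \<in> S u"
    proof (rule ccontr)
      assume "z \<notin> S u"
      moreover have "z \<in> V" using tubing_subset[OF assms(2)] yz(3) by blast
      ultimately have "u \<in> S z" using tubing_edge[OF assms(1) yz(1) _ yz(4)] by blast
      then show False using * tubing_trans[OF assms(2) yz(3)] by blast
    qed
  qed fact
  moreover have "component E (S v) x = S v"
    using component_eq[of x E "S v" v] tubing_connected[OF assms(2)] assms(4) by simp
  ultimately show False using * tubing_refl[OF assms(2)] by blast
qed

lemma arcsD:
  assumes "(i, j) \<in> arcs V S"
  shows "i \<in> V" "j \<in> V" "j \<in> S i" "i \<noteq> j" "i \<notin> S j" "S j \<subseteq> S i - {i}"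
    "\<And>w. w \<in> S i \<Longrightarrow> j \<in> S w \<Longrightarrow> w = i \<or> w = j"
proof -
  show *: "i \<in> V" "j \<in> S i" "i \<noteq> j" "\<And>w. w \<in> S i \<Longrightarrow> j \<in> S w \<Longrightarrow> w = i \<or> w = j"
    using assms by (auto simp: arcs_def)
  show "j \<in> V" using tubing_subset * by blast
  show "S j \<subseteq> S i - {i}" using tubing_below * by metis
  then show "i \<notin> S j" by blast
qed

text \<open>An edge that avoids \<open>i\<close> and leaves \<open>S j\<close> inside
  \<open>S i\<close> would lead to a vertex strictly between \<open>i\<close> and \<open>j\<close>.
  Here the order encoding meets the recursion over components in \<open>elim_tree\<close>.\<close>

lemma arc_component:
  assumes "(i, j) \<in> arcs V S"
  shows "component E (S i - {i}) j = S j"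
proof
  note a = arcsD[OF assms]
  show "S j \<subseteq> component E (S i - {i}) j"
    using tubing_connected[OF a(2)] component_mono[OF a(6)] by metis
  show "component E (S i - {i}) j \<subseteq> S j"
  proof (rule component_closed)
    show "j \<in> S j" using tubing_refl a by blast
    fix x y assume xy: "x \<in> S j" "x \<in> S i - {i}" "y \<in> S i - {i}" "{x, y} \<in> E"
    show "y \<in> S j"
    proof (rule ccontr)
      assume "y \<notin> S j"
      then have "j \<in> S y" using tubing_edge[OF a(2) xy(1) _ xy(4)] xy(3) tubing_subset[OF a(1)] by blast
      then have "y = i \<or> y = j" using a(7) xy by blast
      then show False using xy tubing_refl a \<open>y \<notin> S j\<close> by blast
    qed
  qed
qed

lemma arcs_subset: "arcs V S \<subseteq> V \<times> V"
  using arcsD by auto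

text \<open>Induction on the length of the interval from \<open>u\<close> down to \<open>v\<close>,
  measured by the difference of the tube sizes; a vertex strictly between splits it into two shorter
  intervals.\<close>

lemma arc_between:
  assumes fin: "finite V" and "u \<in> V" "v \<in> S u"
  shows "(u, v) \<in> (arcs V S)\<^sup>*"
  using assms(2,3)
proof (induction "card (S u) - card (S v)" arbitrary: u v rule: less_induct)
  case less
  show ?case
  proof (cases "v = u \<or> (u, v) \<in> arcs V S")
    case True then show ?thesis by auto
  next
    case False
    then obtain w where w: "w \<in> S u" "v \<in> S w" "w \<noteq> u" "w \<noteq> v"
      using less.prems by (auto simp: arcs_def)
    have V: "w \<in> V" "v \<in> V" using w less.prems tubing_subset by blast+
    have "S w \<subset> S u" using tubing_below[OF less.prems(1) w(1) w(3)] tubing_refl[OF less.prems(1)] by blast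
    moreover have "S v \<subset> S w" using tubing_below[OF V(1) w(2)] w(4) tubing_refl[OF V(1)] by blast
    moreover have "finite (S u)" using fin tubing_subset[OF less.prems(1)] finite_subset by blast
    ultimately have "card (S w) < card (S u)" "card (S v) < card (S w)"
      by (meson psubset_card_mono finite_subset psubset_imp_subset)+
    then have "(u, w) \<in> (arcs V S)\<^sup>*" "(w, v) \<in> (arcs V S)\<^sup>*"
      using less.hyps w V less.prems by auto
    then show ?thesis by (rule rtrancl_trans)
  qed
qed

text \<open>Shows that the encoding is faithful: the values of \<open>S\<close> on \<open>V\<close>
  can be read back from the arcs.\<close>

lemma subtree_arcs:
  assumes "finite V" "u \<in> V"
  shows "subtree (arcs V S) u = S u"
proof
  show "S u \<subseteq> subtree (arcs V S) u" using arc_between assms by (auto simp: subtree_def)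
  have "v \<in> S u" if "(u, v) \<in> (arcs V S)\<^sup>*" for v
    using that
  proof (induction rule: rtrancl_induct)
    case base then show ?case using tubing_refl assms by blast
  next
    case (step y z)
    then show ?case using tubing_trans[OF assms(2)] by (auto simp: arcs_def)
  qed
  then show "subtree (arcs V S) u \<subseteq> S u" by (auto simp: subtree_def)
qed

lemma parent_exists:
  assumes fin: "finite V" and u: "u \<in> V" "v \<in> S u" "v \<noteq> u"
  shows "\<exists>w. (w, v) \<in> arcs V S" and "\<exists>w. (u, w) \<in> arcs V S \<and> v \<in> S w"
proof -
  have "(u, v) \<in> (arcs V S)\<^sup>*" using arc_between assms by blast
  with \<open>v \<noteq> u\<close> have *: "(u, v) \<in> (arcs V S)\<^sup>+" by (metis rtranclD)
  show "\<exists>w. (w, v) \<in> arcs V S" using tranclD2[OF *] by blast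
  obtain w where "(u, w) \<in> arcs V S" "(w, v) \<in> (arcs V S)\<^sup>*" using tranclD[OF *] by blast
  then show "\<exists>w. (u, w) \<in> arcs V S \<and> v \<in> S w"
    using subtree_arcs[OF fin, of w] arcs_subset by (auto simp: subtree_def)
qed

lemma parent_unique:
  assumes "(u, v) \<in> arcs V S" "(w, v) \<in> arcs V S"
  shows "u = w"
  using tubing_chain[of u w v] arcsD[OF assms(1)] arcsD[OF assms(2)] by metis

lemma tubing_subset_component:
  assumes "u \<in> V"
  shows "S u \<subseteq> component E V u"
  using tubing_connected[OF assms] component_mono[OF tubing_subset[OF assms], of E u] by simp

end

lemma arcs_cong:
  assumes "\<And>u. u \<in> V \<Longrightarrow> S u = S' u" "\<And>u. u \<in> V \<Longrightarrow> S u \<subseteq> V"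
  shows "arcs V S = arcs V S'"
proof -
  have *: "(\<forall>w\<in>S u. v \<in> S w \<longrightarrow> w = u \<or> w = v) \<longleftrightarrow> (\<forall>w\<in>S' u. v \<in> S' w \<longrightarrow> w = u \<or> w = v)"
    if "u \<in> V" for u v
  proof -
    have "S w = S' w" if "w \<in> S u" for w using assms that \<open>u \<in> V\<close> by blast
    then show ?thesis using assms(1)[OF that] by auto
  qed
  have "(u, v) \<in> arcs V S \<longleftrightarrow> (u, v) \<in> arcs V S'" for u v
    using *[of u v] assms(1)[of u] by (cases "u \<in> V") (simp_all add: arcs_def)
  then show ?thesis by auto
qed

lemma tubing_cong:
  assumes "tubing E V S" "\<And>u. u \<in> V \<Longrightarrow> S u = S' u"
  shows "tubing E V S'"
proof (rule tubingI)
  note t = tubing_refl[OF assms(1)] tubing_subset[OF assms(1)] tubing_connected[OF assms(1)]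
    tubing_below[OF assms(1)] tubing_edge[OF assms(1)]
  fix u assume u: "u \<in> V"
  note e = assms(2)[OF u]
  show "u \<in> S' u" "S' u \<subseteq> V" "component E (S' u) u = S' u"
    using t(1-3)[OF u] e by simp_all
  show "S' v \<subseteq> S' u - {u}" if "v \<in> S' u" "v \<noteq> u" for v
  proof -
    have "v \<in> V" using that(1) e t(2)[OF u] by auto
    then show ?thesis using t(4)[OF u, of v] that e assms(2)[of v] by simp
  qed
  show "u \<in> S' y" if "x \<in> S' u" "y \<in> V" "{x, y} \<in> E" "y \<notin> S' u" for x y
    using t(5)[OF u _ that(2,3)] that e assms(2)[OF that(2)] by simp
qed

text \<open>In this encoding a rotation changes only two values of \<open>S\<close>.\<close>

definition tube_rotate :: "'a set set \<Rightarrow> ('a \<Rightarrow> 'a set) \<Rightarrow> 'a \<Rightarrow> 'a \<Rightarrow> 'a \<Rightarrow> 'a set" where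
  "tube_rotate E S i j = S(j := S i, i := component E (S i - {j}) i)"

lemma tube_rotate_simps:
  "i \<noteq> j \<Longrightarrow> tube_rotate E S i j j = S i"
  "tube_rotate E S i j i = component E (S i - {j}) i"
  "u \<noteq> i \<Longrightarrow> u \<noteq> j \<Longrightarrow> tube_rotate E S i j u = S u"
  by (auto simp: tube_rotate_def)

context
  fixes E :: "'a set set" and V :: "'a set" and S :: "'a \<Rightarrow> 'a set" and i j
  assumes tub: "tubing E V S" and arc: "(i, j) \<in> arcs V S"
begin

private lemmas a = arcsD[OF tub arc]

private lemma rot_sub: "component E (S i - {j}) i \<subseteq> S i - {j}"
  by (rule component_subset) (use a tubing_refl[OF tub] in auto)

private lemma rot_below:
  assumes "v \<in> S i" "v \<noteq> i" "v \<noteq> j" shows "j \<notin> S v"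
  using a(7) assms by blast

private lemma rot_above:
  assumes "u \<in> V" "j \<in> S u" "u \<noteq> i" "u \<noteq> j" shows "i \<in> S u"
  using tubing_chain[OF tub a(1) assms(1) a(3) assms(2)] a(7) assms by blast

lemma tubing_tube_rotate: "tubing E V (tube_rotate E S i j)"
proof (rule tubingI)
  note [simp] = tube_rotate_simps(1)[OF a(4)] tube_rotate_simps(2,3)
  have iS: "i \<in> S i" "i \<in> S i - {j}" using tubing_refl[OF tub a(1)] a(4) by auto
  have Si: "component E (S i) i = S i" using tubing_connected[OF tub a(1)] .
  fix u assume u: "u \<in> V"
  consider (i) "u = i" | (j) "u = j" | (o) "u \<noteq> i" "u \<noteq> j" by blast
  note cs = this
  show "u \<in> tube_rotate E S i j u" using cs a tubing_refl[OF tub u] by cases auto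
  show "tube_rotate E S i j u \<subseteq> V"
    using cs tubing_subset[OF tub u] rot_sub tubing_subset[OF tub a(1)] by cases auto
  show "component E (tube_rotate E S i j u) u = tube_rotate E S i j u"
    using cs
  proof cases
    case i then show ?thesis using component_component[OF iS(2)] by simp
  next
    case j then show ?thesis using component_eq[of j E "S i" i] a(3) Si by simp
  next
    case o then show ?thesis using tubing_connected[OF tub u] by simp
  qed
  show "tube_rotate E S i j v \<subseteq> tube_rotate E S i j u - {u}" if v: "v \<in> tube_rotate E S i j u" "v \<noteq> u" for v
    using cs
  proof cases
    case i
    then have vD: "v \<in> component E (S i - {j}) i" using v by simp
    then have vS: "v \<in> S i" "v \<noteq> i" "v \<noteq> j" using rot_sub v i by auto
    have sub: "S v \<subseteq> S i - {j}" "i \<notin> S v" using tubing_below[OF tub a(1) vS(1,2)] rot_below[OF vS] by blast+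
    have "v \<in> V" using vS tubing_subset[OF tub a(1)] by blast
    then have "S v \<subseteq> component E (S i - {j}) v"
      using tubing_connected[OF tub] component_mono[OF sub(1)] by metis
    then show ?thesis using i vS sub component_eq[OF vD] by auto
  next
    case j
    then have vS: "v \<in> S i" "v \<noteq> j" using v by auto
    show ?thesis
    proof (cases "v = i")
      case True then show ?thesis using j rot_sub by auto
    next
      case False then show ?thesis
        using j vS tubing_below[OF tub a(1) vS(1)] rot_below by auto
    qed
  next
    case o
    then have vS: "v \<in> S u" using v by simp
    show ?thesis
    proof (cases "v = i \<or> v = j")
      case True
      then have "i \<in> S u" using rot_above u o vS by blast
      then have "S i \<subseteq> S u - {u}" using tubing_below[OF tub u] o by blast
      then show ?thesis using True rot_sub o by auto
    next
      case False
      then show ?thesis using o vS tubing_below[OF tub u vS v(2)] by simp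
    qed
  qed
  show "u \<in> tube_rotate E S i j y"
    if x: "x \<in> tube_rotate E S i j u" and y: "y \<in> V" "{x, y} \<in> E" "y \<notin> tube_rotate E S i j u" for x y
    using cs
  proof cases
    case i
    then have x: "x \<in> component E (S i - {j}) i" "x \<in> S i" "x \<noteq> j" using rot_sub x by auto
    show ?thesis
    proof (cases "y \<in> S i")
      case True
      then have "y = j" using component_step[of x E "S i - {j}" i y] x y i by auto
      then show ?thesis using i iS by simp
    next
      case False
      then have "i \<in> S y" using tubing_edge[OF tub a(1) x(2) y(1,2)] by blast
      then show ?thesis using False a iS i by (cases "y = j"; cases "y = i") auto
    qed
  next
    case j
    then have y': "y \<notin> S i" using y by simp
    then have "i \<in> S y" using tubing_edge[OF tub a(1) _ y(1,2)] x j by simp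
    then have "S i \<subseteq> S y" using tubing_trans[OF tub y(1)] by blast
    then show ?thesis using y' a iS j by (cases "y = j"; cases "y = i") auto
  next
    case o
    then have "x \<in> S u" "y \<notin> S u" using x y by auto
    then have uy: "u \<in> S y" using tubing_edge[OF tub u _ y(1,2)] by blast
    show ?thesis
    proof (cases "y = i")
      \<comment> \<open>The tube of \<open>i\<close> shrinks, so it has to be checked that it keeps
        \<open>u\<close>: the connected set \<open>S u\<close> avoids \<open>j\<close> and has an
        edge to \<open>i\<close>, hence lies in the component of \<open>i\<close> that survives the
        removal of \<open>j\<close>.\<close>
      case True
      then have ui: "u \<in> S i" using uy by simp
      have "j \<notin> S u" using rot_below ui o by blast
      then have sub: "S u \<subseteq> S i - {j}" using tubing_trans[OF tub a(1) ui] by blast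
      then have "S u \<subseteq> component E (S i - {j}) u"
        using tubing_connected[OF tub u] component_mono[OF sub] by metis
      then have xu: "x \<in> component E (S i - {j}) u" using \<open>x \<in> S u\<close> by blast
      then have "i \<in> component E (S i - {j}) u"
        using component_step[of x E "S i - {j}" u i] iS y True \<open>x \<in> S u\<close> sub by auto
      then have "component E (S i - {j}) i = component E (S i - {j}) u" by (rule component_eq)
      then show ?thesis using True by simp
    next
      case False
      then show ?thesis using uy a(6) by (cases "y = j") auto
    qed
  qed
qed

lemma rev_arc_tube_rotate: "(j, i) \<in> arcs V (tube_rotate E S i j)"
proof -
  have "w = i \<or> w = j" if "w \<in> S i" "i \<in> tube_rotate E S i j w" for w
  proof (rule ccontr)
    assume *: "\<not> ?thesis"
    then have "i \<in> S w" using that by (simp add: tube_rotate_simps)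
    then show False using tubing_antisym[OF tub a(1) that(1)] * by simp
  qed
  then show ?thesis using a(2,4) tubing_refl[OF tub a(1)]
    by (auto simp: arcs_def tube_rotate_simps(1)[OF a(4)])
qed

text \<open>By \<open>arc_component\<close>, removing \<open>i\<close> from \<open>S i\<close>
  leaves the old \<open>S j\<close> as the component of \<open>j\<close>. Reversibility of rotations
  rests on this.\<close>

lemma tube_rotate_tube_rotate: "tube_rotate E (tube_rotate E S i j) j i = S"
proof
  fix u
  show "tube_rotate E (tube_rotate E S i j) j i u = S u"
    using arc_component[OF tub arc] a(4) by (auto simp: tube_rotate_def)
qed

text \<open>Only the inclusion from left to right is checked arc by arc. For the converse it
  suffices that every vertex with a parent in the new tubing also has one in the rotated arc set,
  since parents are unique.\<close>

lemma rotation_arcs: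
  assumes fin: "finite V"
  shows "rotation E (arcs V S) i j = arcs V (tube_rotate E S i j)"
proof -
  let ?D = "component E (S i - {j}) i" and ?F = "arcs V S" and ?S = "tube_rotate E S i j"
  have iS: "i \<in> S i" "i \<in> S i - {j}" using tubing_refl[OF tub a(1)] a(4) by auto
  note [simp] = tube_rotate_simps(1)[OF a(4)] tube_rotate_simps(2,3)
  note tub' = tubing_tube_rotate
  \<comment> \<open>A child subtree of \<open>j\<close> is a tube of the rotated tubing too, so it
    lies in the new tube \<open>?D\<close> of \<open>i\<close> as soon as its root does.\<close>
  have M: "k \<in> moved E ?F i j \<longleftrightarrow> (j, k) \<in> ?F \<and> k \<in> ?D" for k
  proof -
    have "S k \<subseteq> ?D \<longleftrightarrow> k \<in> ?D" if jk: "(j, k) \<in> ?F"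
    proof
      have k: "k \<in> V" "k \<noteq> i" "k \<noteq> j" using arcsD[OF tub jk] a by auto
      show "S k \<subseteq> ?D \<Longrightarrow> k \<in> ?D" using tubing_refl[OF tub k(1)] by blast
      show "k \<in> ?D \<Longrightarrow> S k \<subseteq> ?D" using tubing_trans[OF tub' a(1), of k] k by simp
    qed
    then show ?thesis
      using subtree_arcs[OF tub fin, of k] subtree_arcs[OF tub fin a(1)] arcs_subset[OF tub]
      by (auto simp: moved_def)
  qed
  \<comment> \<open>\<open>rotation\<close> leaves the other children of \<open>i\<close> in place,
    so they must belong to the smaller tube of \<open>i\<close>.\<close>
  have child_i: "b \<in> ?D" if b: "(i, b) \<in> ?F" "b \<noteq> j" for b
  proof -
    note b' = arcsD[OF tub b(1)]
    have jb: "j \<notin> S b" using a(7)[of b] b b' by auto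
    have Sb: "S b \<subseteq> S i - {j}" using b' jb by blast
    \<comment> \<open>The connected set \<open>S i\<close> has an edge leaving \<open>S b\<close>, and it can only lead to \<open>i\<close>.\<close>
    have "\<exists>x\<in>S b. {x, i} \<in> E"
    proof (rule ccontr)
      assume no: "\<not> ?thesis"
      have "component E (S i) b \<subseteq> S b"
      proof (rule component_closed)
        fix x y assume xy: "x \<in> S b" "x \<in> S i" "y \<in> S i" "{x, y} \<in> E"
        have "y \<noteq> i" using xy no by auto
        moreover have "y \<in> V" using xy tubing_subset[OF tub a(1)] by blast
        ultimately show "y \<in> S b"
          using tubing_edge[OF tub b'(2) xy(1) _ xy(4)] b'(7)[OF xy(3)] tubing_refl[OF tub b'(2)] by blast
      qed (rule tubing_refl[OF tub b'(2)])
      moreover have "component E (S i) b = S i"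
        using component_eq[of b E "S i" i] tubing_connected[OF tub a(1)] b' by simp
      ultimately show False using b' iS by blast
    qed
    then obtain x where x: "x \<in> S b" "{x, i} \<in> E" by blast
    have "S b \<subseteq> component E (S i - {j}) b"
      using tubing_connected[OF tub b'(2)] component_mono[OF Sb] by metis
    then have "i \<in> component E (S i - {j}) b"
      using component_step[of x E "S i - {j}" b i] x iS Sb by blast
    then show ?thesis using component_eq by (metis component_refl)
  qed
  have sub: "rotation E ?F i j \<subseteq> arcs V ?S"
  proof
    fix e assume "e \<in> rotation E ?F i j"
    then consider (old) b c where "e = (b, c)" "(b, c) \<in> ?F" "c \<noteq> i" "c \<noteq> j" "c \<notin> moved E ?F i j"
      | (top) b where "e = (b, j)" "(b, i) \<in> ?F"
      | (swap) "e = (j, i)"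
      | (mov) k where "e = (i, k)" "k \<in> moved E ?F i j"
      unfolding rotation_def by auto
    then show "e \<in> arcs V ?S"
    proof cases
      case swap then show ?thesis using rev_arc_tube_rotate by simp
    next
      case top
      note t = arcsD[OF tub top(2)]
      have bj: "b \<noteq> j" "b \<noteq> i" using t a by auto
      have "w = b \<or> w = j" if w: "w \<in> S b" "j \<in> ?S w" for w
      proof (rule ccontr)
        assume *: "\<not> ?thesis"
        have "w \<noteq> i" using w rot_sub by auto
        then have "j \<in> S w" using w * by simp
        moreover have "w \<in> V" using w tubing_subset[OF tub t(1)] by blast
        ultimately have "i \<in> S w" using rot_above * \<open>w \<noteq> i\<close> by blast
        then show False using t(7)[OF w(1)] * \<open>w \<noteq> i\<close> by simp
      qed
      moreover have "j \<in> S b" using tubing_trans[OF tub t(1,3)] a(3) by blast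
      ultimately show ?thesis using top(1) bj t(1) by (auto simp: arcs_def)
    next
      case mov
      then have k: "(j, k) \<in> ?F" "k \<in> ?D" using M by auto
      note k' = arcsD[OF tub k(1)]
      have kn: "k \<noteq> i" "k \<noteq> j" using k' a by auto
      have "w = i \<or> w = k" if w: "w \<in> ?D" "k \<in> ?S w" for w
      proof (rule ccontr)
        assume *: "\<not> ?thesis"
        have wj: "w \<noteq> j" "w \<in> S i" using w rot_sub by auto
        then have kw: "k \<in> S w" using w * by simp
        have wV: "w \<in> V" using wj tubing_subset[OF tub a(1)] by blast
        have "j \<in> S w \<or> w \<in> S j" using tubing_chain[OF tub k'(1) wV k'(3) kw] .
        then show False using a(7)[OF wj(2)] k'(7) kw * wj by blast
      qed
      then show ?thesis using mov(1) a(1) k kn by (auto simp: arcs_def)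
    next
      case old
      note o = arcsD[OF tub old(2)]
      show ?thesis
      proof (cases "b = i")
        case True
        then have c: "c \<in> ?D" using child_i old by blast
        have "w = i \<or> w = c" if w: "w \<in> ?D" "c \<in> ?S w" for w
          using w o(7)[of w] rot_sub True by (cases "w = i"; cases "w = j") auto
        then show ?thesis using old True c o by (auto simp: arcs_def)
      next
        case bi: False
        show ?thesis
        proof (cases "b = j")
          case True
          have nc: "c \<notin> ?D" using old M True by blast
          have cj: "c \<in> S j" using o True by simp
          have "w = j \<or> w = c" if w: "w \<in> S i" "c \<in> ?S w" for w
          proof (rule ccontr)
            assume *: "\<not> ?thesis"
            have wi: "w \<noteq> i" using w nc by auto
            then have cw: "c \<in> S w" using w * by simp
            have wV: "w \<in> V" using w tubing_subset[OF tub a(1)] by blast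
            have "j \<in> S w \<or> w \<in> S j" using tubing_chain[OF tub a(2) wV cj cw] .
            then show False using a(7)[OF w(1)] o(7)[of w] cw * wi True by blast
          qed
          then show ?thesis using True old a(6) cj a(2) by (auto simp: arcs_def)
        next
          case bj: False
          have "w = b \<or> w = c" if w: "w \<in> S b" "c \<in> ?S w" for w
          proof -
            consider "w = i" | "w = j" | "w \<noteq> i" "w \<noteq> j" by blast
            then show ?thesis
            proof cases
              case 1 then show ?thesis using o(7)[OF w(1)] w rot_sub by auto
            next
              case 2
              then have "c \<in> S i" using w by simp
              moreover have "i \<in> S b" using rot_above[OF o(1)] w 2 bi bj by blast
              ultimately show ?thesis using o(7)[of i] bi old by blast
            next
              case 3 then show ?thesis using o(7)[OF w(1)] w by auto
            qed
          qed
          then show ?thesis using bi bj old o by (auto simp: arcs_def)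
        qed
      qed
    qed
  qed
  have "arcs V ?S \<subseteq> rotation E ?F i j"
  proof
    fix e assume e: "e \<in> arcs V ?S"
    obtain b c where bc: "e = (b, c)" by (cases e)
    note e' = arcsD[OF tub' e[unfolded bc]]
    have "\<exists>d. (d, c) \<in> rotation E ?F i j"
    proof (cases "c = i")
      case True then show ?thesis by (auto simp: rotation_def)
    next
      case ci: False
      show ?thesis
      proof (cases "c = j")
        case True
        have bi: "b \<noteq> i" using e'(3) rot_sub True by auto
        have "i \<in> S b" using rot_above[OF e'(1)] e' bi True by simp
        then have "\<exists>d. (d, i) \<in> ?F" using parent_exists(1)[OF tub fin e'(1)] bi by blast
        then show ?thesis using True by (auto simp: rotation_def)
      next
        case cj: False
        have "\<exists>d\<in>V. c \<in> S d \<and> c \<noteq> d"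
        proof (cases "b = i \<or> b = j")
          case True
          then have "c \<in> S i" using e'(3) rot_sub by auto
          then show ?thesis using ci a by blast
        next
          case False
          then show ?thesis using e' by auto
        qed
        then obtain d where "(d, c) \<in> ?F" using parent_exists(1)[OF tub fin] by blast
        then show ?thesis using ci cj by (auto simp: rotation_def)
      qed
    qed
    then obtain d where d: "(d, c) \<in> rotation E ?F i j" by blast
    then have "(d, c) \<in> arcs V ?S" using sub by blast
    then have "d = b" using parent_unique[OF tub'] e bc by blast
    then show "e \<in> rotation E ?F i j" using d bc by simp
  qed
  with sub show ?thesis by blast
qed

end

section \<open>Elimination forests as tubings\<close>

text \<open>Take a vertex with the largest tube. By the third axiom an edge leaving that tube would
  lead to a vertex with a strictly larger one.\<close>

lemma tubing_root_exists:
  assumes tub: "tubing E U S" and fin: "finite U" and con: "connected_on E U"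
  shows "\<exists>x\<in>U. S x = U"
proof -
  have "U \<noteq> {}" using con by (simp add: connected_on_def)
  then have "Max ((\<lambda>y. card (S y)) ` U) \<in> (\<lambda>y. card (S y)) ` U" using fin by (intro Max_in) auto
  then obtain x where x: "x \<in> U" "card (S x) = Max ((\<lambda>y. card (S y)) ` U)" by auto
  have max: "card (S y) \<le> card (S x)" if "y \<in> U" for y
    unfolding x(2) using fin that by (intro Max_ge) auto
  have "component E U x \<subseteq> S x"
  proof (rule component_closed)
    show "x \<in> S x" using tubing_refl[OF tub x(1)] .
    fix y z assume yz: "y \<in> S x" "y \<in> U" "z \<in> U" "{y, z} \<in> E"
    show "z \<in> S x"
    proof (rule ccontr)
      assume z: "z \<notin> S x"
      then have xz: "x \<in> S z" using tubing_edge[OF tub x(1) yz(1,3,4)] by blast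
      then have "S x \<subset> S z" using tubing_trans[OF tub yz(3) xz] tubing_refl[OF tub yz(3)] z by blast
      moreover have "finite (S z)" using tubing_subset[OF tub yz(3)] fin finite_subset by blast
      ultimately show False using max[OF yz(3)] psubset_card_mono[of "S z" "S x"] by linarith
    qed
  qed
  then have "S x = U" using connected_on_component[OF con x(1)] tubing_subset[OF tub x(1)] by auto
  then show ?thesis using x by blast
qed

lemma tubing_restrict:
  assumes tub: "tubing E V S" and W: "W \<subseteq> V" and S: "\<And>u. u \<in> W \<Longrightarrow> S u \<subseteq> W"
  shows "tubing E W S"
proof (rule tubingI)
  fix u assume "u \<in> W"
  then have u: "u \<in> V" using W by blast
  show "u \<in> S u" "component E (S u) u = S u" using tubing_refl[OF tub u] tubing_connected[OF tub u] .
  show "S u \<subseteq> W" using S \<open>u \<in> W\<close> .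
  show "\<And>v. v \<in> S u \<Longrightarrow> v \<noteq> u \<Longrightarrow> S v \<subseteq> S u - {u}" using tubing_below[OF tub u] .
  show "\<And>x y. x \<in> S u \<Longrightarrow> y \<in> W \<Longrightarrow> {x, y} \<in> E \<Longrightarrow> y \<notin> S u \<Longrightarrow> u \<in> S y"
    using tubing_edge[OF tub u] W by blast
qed

lemma tubing_component:
  assumes tub: "tubing E V S" and C: "C \<in> components E V"
  shows "tubing E C S"
  using tub components_subset[OF C]
proof (rule tubing_restrict)
  fix u assume "u \<in> C"
  then show "S u \<subseteq> C"
    using tubing_subset_component[OF tub] components_subset[OF C] components_eq[OF C] by blast
qed

lemma tubing_remove_root:
  assumes tub: "tubing E U S" and x: "x \<in> U" "S x = U"
  shows "tubing E (U - {x}) S"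
  using tub
proof (rule tubing_restrict)
  fix u assume "u \<in> U - {x}"
  then show "S u \<subseteq> U - {x}" using tubing_below[OF tub x(1), of u] x(2) by simp
qed auto

text \<open>Being an arc depends on the base set only through the upper end \<open>u\<close>, so
  arcs split along any partition of \<open>V\<close>.\<close>

lemma arcs_components: "arcs V S = (\<Union>C\<in>components E V. arcs C S)"
proof -
  define P where "P u v \<longleftrightarrow> v \<in> S u \<and> v \<noteq> u \<and> (\<forall>w\<in>S u. v \<in> S w \<longrightarrow> w = u \<or> w = v)" for u v
  have *: "(u, v) \<in> arcs W S \<longleftrightarrow> u \<in> W \<and> P u v" for u v W
    by (simp add: arcs_def P_def)
  have "u \<in> V \<longleftrightarrow> (\<exists>C\<in>components E V. u \<in> C)" for u
    using components_subset[of _ E V] component_in_components[of u V E] component_refl[of u E V]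
    by blast
  then show ?thesis by (auto simp: *)
qed

lemma arcs_root:
  assumes tub: "tubing E U S" and x: "x \<in> U" "S x = U"
    and r: "\<And>C. C \<in> components E (U - {x}) \<Longrightarrow> r C \<in> C \<and> S (r C) = C"
  shows "arcs U S = (\<Union>C\<in>components E (U - {x}). insert (x, r C) (arcs C S))"
proof -
  let ?K = "components E (U - {x})"
  have tub': "tubing E (U - {x}) S" using tubing_remove_root[OF tub x] .
  have 1: "arcs U S = {e \<in> arcs U S. fst e = x} \<union> arcs (U - {x}) S"
    unfolding arcs_def using x by auto
  have "(x, v) \<in> arcs U S \<longleftrightarrow> v \<in> r ` ?K" for v
  proof
    assume v: "(x, v) \<in> arcs U S"
    note v' = arcsD[OF tub v]
    have C: "S v \<in> ?K" using arc_component[OF tub v] component_in_components[of v "U - {x}" E] v' x by simp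
    have "r (S v) \<in> S v" "v \<in> S (r (S v))" using r[OF C] tubing_refl[OF tub v'(2)] by auto
    then have "v = r (S v)" using tubing_antisym[OF tub v'(2)] by blast
    then show "v \<in> r ` ?K" using C by blast
  next
    assume "v \<in> r ` ?K"
    then obtain C where C: "C \<in> ?K" "v = r C" by blast
    then have v: "v \<in> C" "S v = C" using r by auto
    have CU: "C \<subseteq> U - {x}" using components_subset[OF C(1)] .
    \<comment> \<open>A vertex above \<open>v\<close> other than \<open>x\<close> lies in the same
      component \<open>C = S v\<close>, hence also below \<open>v\<close>.\<close>
    have "w = v" if w: "w \<in> U" "v \<in> S w" "w \<noteq> x" for w
    proof -
      have "S w \<subseteq> component E (U - {x}) w" using tubing_subset_component[OF tub'] w by blast
      then have "component E (U - {x}) w = C"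
        using w(2) component_eq components_eq[OF C(1) v(1)] by (metis subsetD)
      then have "w \<in> S v" using v component_refl by metis
      then show ?thesis using tubing_antisym[OF tub w(1) w(2)] by simp
    qed
    then show "(x, v) \<in> arcs U S" unfolding arcs_def using v CU x by auto
  qed
  then have 2: "{e \<in> arcs U S. fst e = x} = Pair x ` r ` ?K" by auto
  show ?thesis using 1 arcs_components[of "U - {x}" S E] unfolding 2 by blast
qed

section \<open>From tubings to elimination trees and forests\<close>

lemma elim_tree_arcs:
  assumes "tubing E U S" "finite U" "connected_on E U"
  shows "\<exists>x\<in>U. S x = U \<and> elim_tree E U x (arcs U S)"
  using assms
proof (induction "card U" arbitrary: U rule: less_induct)
  case less
  note tub = less.prems(1)
  obtain x where x: "x \<in> U" "S x = U" using tubing_root_exists[OF less.prems] by blast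
  have "\<exists>y\<in>C. S y = C \<and> elim_tree E C y (arcs C S)" if C: "C \<in> components E (U - {x})" for C
  proof (rule less.hyps)
    have "C \<subset> U" using components_subset[OF C] x by blast
    then show "card C < card U" "finite C" using less.prems(2) by (auto intro: psubset_card_mono finite_subset)
    show "tubing E C S" using tubing_component[OF tubing_remove_root[OF tub x] C] .
    show "connected_on E C" using connected_on_components[OF C] .
  qed
  then obtain r where r: "\<And>C. C \<in> components E (U - {x}) \<Longrightarrow>
      r C \<in> C \<and> S (r C) = C \<and> elim_tree E C (r C) (arcs C S)"
    by metis
  have "elim_tree E U x (\<Union>C\<in>components E (U - {x}). insert (x, r C) (arcs C S))"
    using less.prems(3) x(1) by (rule elim_treeI) (use r in blast)
  then show ?case using arcs_root[OF tub x, of r] r x by auto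
qed

lemma elim_forest_arcs:
  assumes "tubing E V S" "finite V"
  shows "elim_forest V E (arcs V S)"
proof -
  have "\<exists>x. elim_tree E C x (arcs C S)" if C: "C \<in> components E V" for C
    using elim_tree_arcs[OF tubing_component[OF assms(1) C] _ connected_on_components[OF C]]
      components_subset[OF C] assms(2) finite_subset by blast
  then show ?thesis unfolding elim_forest_def
    using arcs_components[of V S E] by (intro exI[of _ "\<lambda>C. arcs C S"]) auto
qed

section \<open>From elimination trees and forests back to tubings\<close>

lemma tubing_glue:
  assumes S: "\<And>C. C \<in> components E W \<Longrightarrow> tubing E C (S C)"
  shows "tubing E W (\<lambda>u. S (component E W u) u)"
    and "arcs W (\<lambda>u. S (component E W u) u) = (\<Union>C\<in>components E W. arcs C (S C))"
proof -
  let ?S = "\<lambda>u. S (component E W u) u"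
  have S': "tubing E C ?S" if C: "C \<in> components E W" for C
    using S[OF C] by (rule tubing_cong) (use components_eq[OF C] in simp)
  show "tubing E W ?S"
  proof (rule tubingI)
    fix u assume u: "u \<in> W"
    let ?C = "component E W u"
    have C: "?C \<in> components E W" using component_in_components[OF u] .
    have uC: "u \<in> ?C" by simp
    note t = S'[OF C]
    show "u \<in> ?S u" "component E (?S u) u = ?S u"
      using tubing_refl[OF t uC] tubing_connected[OF t uC] .
    show "?S u \<subseteq> W" using tubing_subset[OF t uC] components_subset[OF C] by blast
    show "\<And>v. v \<in> ?S u \<Longrightarrow> v \<noteq> u \<Longrightarrow> ?S v \<subseteq> ?S u - {u}" using tubing_below[OF t uC] .
    fix x y assume xy: "x \<in> ?S u" "y \<in> W" "{x, y} \<in> E" "y \<notin> ?S u"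
    have "x \<in> ?C" using xy(1) tubing_subset[OF t uC] by blast
    then have "y \<in> ?C" using component_step[of x E W u y] xy components_subset[OF C] by blast
    then show "u \<in> ?S y" using tubing_edge[OF t uC xy(1) _ xy(3,4)] by blast
  qed
  have "arcs C ?S = arcs C (S C)" if C: "C \<in> components E W" for C
    by (rule arcs_cong) (use components_eq[OF C] tubing_subset[OF S'[OF C]] in auto)
  then show "arcs W ?S = (\<Union>C\<in>components E W. arcs C (S C))"
    using arcs_components[of W ?S E] by auto
qed

text \<open>Used twice: for the root in the recursion of \<open>elim_tree\<close>, and for putting
  \<open>n\<close> back on top of a forest of the smaller graph. In the second case \<open>W\<close>
  may be disconnected around the new vertex, so its tube is only its own component.\<close>

lemma tubing_add_root:
  assumes tub: "tubing E W S" and x: "x \<notin> W" "C \<subseteq> insert x W"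
    and C: "component E (insert x W) x = C"
  shows "tubing E (insert x W) (S(x := C))" (is "tubing E ?U ?S")
proof (rule tubingI)
  have xC: "x \<in> C" using C component_refl by metis
  fix u assume u: "u \<in> ?U"
  have old: "v \<in> W \<Longrightarrow> ?S v = S v \<and> S v \<subseteq> W \<and> x \<notin> S v" for v using x tubing_subset[OF tub, of v] by auto
  show "u \<in> ?S u" using u xC tubing_refl[OF tub] by auto
  show "?S u \<subseteq> ?U" using u old x by auto
  show "component E (?S u) u = ?S u"
    using u old tubing_connected[OF tub] C component_component[of x ?U E] by auto
  \<comment> \<open>An old tube is connected, so it lies inside the component \<open>C\<close> of
    the new vertex or misses it.\<close>
  have S_C: "S v \<subseteq> C" if v: "v \<in> W" "y \<in> S v" "y \<in> C" for v y
  proof -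
    have "S v \<subseteq> component E ?U v"
      using tubing_connected[OF tub v(1)] component_mono[of "S v" ?U E v] old[OF v(1)] by auto
    then have "y \<in> component E ?U v" using v by blast
    then have "component E ?U v = C" using component_eq v(3) C by metis
    then show ?thesis using \<open>S v \<subseteq> component E ?U v\<close> by simp
  qed
  show "?S v \<subseteq> ?S u - {u}" if v: "v \<in> ?S u" "v \<noteq> u" for v
  proof (cases "u = x")
    case True
    then have "v \<in> C" "v \<in> W" using v x by auto
    then show ?thesis using S_C[of v v] old[of v] tubing_refl[OF tub] True by auto
  next
    case False
    then have uW: "u \<in> W" using u by simp
    then have "v \<in> W" using v old by auto
    then show ?thesis using old uW v tubing_below[OF tub uW, of v] by auto
  qed
  show "u \<in> ?S y" if y: "y' \<in> ?S u" "y \<in> ?U" "{y', y} \<in> E" "y \<notin> ?S u" for y' y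
  proof (cases "u = x")
    case True
    then have "y' \<in> component E ?U x" "y' \<in> ?U" using y C x by auto
    then have "y \<in> C" using component_step y C by metis
    then show ?thesis using True y by simp
  next
    case False
    then have uW: "u \<in> W" using u by simp
    show ?thesis
    proof (cases "y = x")
      case True
      have y': "y' \<in> S u" "y' \<in> ?U" using y old[OF uW] by auto
      then have "y' \<in> component E ?U x"
        using component_step[of x E ?U x y'] y(3) True by (simp add: insert_commute)
      then show ?thesis using True S_C[OF uW y'(1)] C tubing_refl[OF tub uW] by auto
    next
      case False
      then show ?thesis using y old uW tubing_edge[OF tub uW, of y' y] by auto
    qed
  qed
qed

lemma elim_tree_tubing:
  "elim_tree E U x T \<Longrightarrow> \<exists>S. tubing E U S \<and> x \<in> U \<and> S x = U \<and> T = arcs U S"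
proof (induction rule: elim_tree.induct)
  case (elim_treeI U x r A)
  let ?W = "U - {x}"
  let ?K = "components E ?W"
  have U: "insert x ?W = U" using elim_treeI.hyps(2) by blast
  have IH: "\<forall>C\<in>?K. \<exists>S. tubing E C S \<and> r C \<in> C \<and> S (r C) = C \<and> A C = arcs C S"
    using elim_treeI.IH by simp
  obtain S where S: "\<And>C. C \<in> ?K \<Longrightarrow> tubing E C (S C) \<and> r C \<in> C \<and> S C (r C) = C \<and> A C = arcs C (S C)"
    using bchoice[OF IH] by blast
  define S1 where "S1 = (\<lambda>u. S (component E ?W u) u)"
  have t1: "tubing E ?W S1" unfolding S1_def by (rule tubing_glue) (use S in blast)
  define S2 where "S2 = S1(x := U)"
  have t2: "tubing E U S2"
    using tubing_add_root[OF t1, of x U] connected_on_component[OF elim_treeI.hyps(1,2)]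
    unfolding U S2_def by blast
  have eq: "S2 u = S C u" if C: "C \<in> ?K" "u \<in> C" for C u
    using components_subset[OF C(1)] components_eq[OF C] C(2) by (auto simp: S2_def S1_def)
  have "arcs U S2 = (\<Union>C\<in>?K. insert (x, r C) (arcs C S2))"
    by (rule arcs_root[OF t2]) (use elim_treeI.hyps(2) S eq in \<open>auto simp: S2_def\<close>)
  moreover have "arcs C S2 = A C" if C: "C \<in> ?K" for C
  proof -
    have "arcs C (S C) = arcs C S2"
      by (rule arcs_cong) (use eq[OF C] S[OF C] tubing_subset in \<open>metis+\<close>)
    then show ?thesis using S[OF C] by simp
  qed
  ultimately have "(\<Union>C\<in>?K. insert (x, r C) (A C)) = arcs U S2" by auto
  moreover have "S2 x = U" by (simp add: S2_def)
  ultimately show ?case using t2 elim_treeI.hyps(2) by blast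
qed

text \<open>The bridge between the two descriptions; all later reasoning about elimination forests
  goes through tubings.\<close>

lemma elim_forest_iff_tubing:
  assumes "finite V"
  shows "elim_forest V E F \<longleftrightarrow> (\<exists>S. tubing E V S \<and> F = arcs V S)"
proof
  assume "elim_forest V E F"
  then obtain A where A: "\<And>C. C \<in> components E V \<Longrightarrow> \<exists>x. elim_tree E C x (A C)"
    and F: "F = (\<Union>C\<in>components E V. A C)"
    unfolding elim_forest_def by blast
  have *: "\<forall>C\<in>components E V. \<exists>S. tubing E C S \<and> A C = arcs C S"
  proof
    fix C assume "C \<in> components E V"
    then obtain x where "elim_tree E C x (A C)" using A by blast
    then show "\<exists>S. tubing E C S \<and> A C = arcs C S" using elim_tree_tubing by fast
  qed
  obtain S where "\<And>C. C \<in> components E V \<Longrightarrow> tubing E C (S C) \<and> A C = arcs C (S C)"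
    using bchoice[OF *] by blast
  then show "\<exists>S. tubing E V S \<and> F = arcs V S"
    using tubing_glue[of E V S] F by (intro exI[of _ "\<lambda>u. S (component E V u) u"]) auto
qed (use elim_forest_arcs assms in blast)

section \<open>Deleting a vertex\<close>

text \<open>
  This is the effect of rotating \<open>n\<close> up to a root and then deleting it.
\<close>

definition tube_del :: "'a set set \<Rightarrow> 'a \<Rightarrow> ('a \<Rightarrow> 'a set) \<Rightarrow> 'a \<Rightarrow> 'a set" where
  "tube_del E n S u = component E (S u - {n}) u"

text \<open>Formulated with \<open>subtree\<close> so that it is a function of the forest: a tubing
  is determined by its arcs only on \<open>V\<close>.\<close>

definition forest_del :: "'a set set \<Rightarrow> 'a set \<Rightarrow> 'a \<Rightarrow> 'a rel \<Rightarrow> 'a rel" where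
  "forest_del E V n F = arcs (V - {n}) (tube_del E n (subtree F))"

lemma tubing_tube_del:
  assumes tub: "tubing E V S"
  shows "tubing E (V - {n}) (tube_del E n S)" (is "tubing E ?V ?S")
proof (rule tubingI)
  fix u assume u': "u \<in> ?V"
  then have u: "u \<in> V" "u \<noteq> n" by auto
  have un: "u \<in> S u - {n}" using tubing_refl[OF tub u(1)] u by blast
  have sub: "?S v \<subseteq> S v - {n}" if "v \<in> V" "v \<noteq> n" for v
    unfolding tube_del_def using component_subset[of v "S v - {n}" E] tubing_refl[OF tub that(1)] that by blast
  show "u \<in> ?S u" by (simp add: tube_del_def)
  show "?S u \<subseteq> ?V" using sub[OF u] tubing_subset[OF tub u(1)] by blast
  show "component E (?S u) u = ?S u" unfolding tube_del_def using component_component[OF un] .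
  show "?S v \<subseteq> ?S u - {u}" if v: "v \<in> ?S u" "v \<noteq> u" for v
  proof -
    have vS: "v \<in> S u" "v \<noteq> n" using v sub[OF u] by auto
    have below: "S v \<subseteq> S u - {u}" using tubing_below[OF tub u(1) vS(1) v(2)] .
    have "v \<in> V" using vS tubing_subset[OF tub u(1)] by blast
    then have "u \<notin> ?S v" using sub[OF _ vS(2)] below by blast
    moreover have "?S v \<subseteq> component E (S u - {n}) v"
      unfolding tube_del_def by (rule component_mono) (use below in blast)
    moreover have "component E (S u - {n}) v = ?S u"
      using component_eq v(1) unfolding tube_del_def by metis
    ultimately show ?thesis by blast
  qed
  show "u \<in> ?S y" if x: "x \<in> ?S u" and y: "y \<in> ?V" "{x, y} \<in> E" "y \<notin> ?S u" for x y
  proof -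
    have xS: "x \<in> S u - {n}" using x sub[OF u] by blast
    have "y \<notin> S u"
      using component_step[of x E "S u - {n}" u y] x xS y unfolding tube_del_def by blast
    then have uy: "u \<in> S y" using tubing_edge[OF tub u(1) _ _ y(2)] xS y(1) by blast
    have yV: "y \<in> V" using y by blast
    have Su: "S u - {n} \<subseteq> S y - {n}" using tubing_trans[OF tub yV uy] by blast
    then have "x \<in> component E (S y - {n}) u"
      using x component_mono[OF Su, of E u] unfolding tube_del_def by blast
    then have "y \<in> component E (S y - {n}) u"
      using component_step[of x E "S y - {n}" u y] xS Su y tubing_refl[OF tub yV] by blast
    then show ?thesis unfolding tube_del_def using component_eq component_refl by metis
  qed
qed

lemma forest_del_arcs:
  assumes "tubing E V S" "finite V"
  shows "forest_del E V n (arcs V S) = arcs (V - {n}) (tube_del E n S)"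
  unfolding forest_del_def
proof (rule arcs_cong)
  fix u assume u: "u \<in> V - {n}"
  then show *: "tube_del E n (subtree (arcs V S)) u = tube_del E n S u"
    using subtree_arcs[OF assms] by (simp add: tube_del_def)
  show "tube_del E n (subtree (arcs V S)) u \<subseteq> V - {n}"
    unfolding * using tubing_subset[OF tubing_tube_del[OF assms(1)] u] .
qed

lemma arcs_inject:
  assumes "tubing E V S" "tubing E V S'" "finite V" "arcs V S = arcs V S'" "u \<in> V"
  shows "S u = S' u"
  using subtree_arcs[OF assms(1,3,5)] subtree_arcs[OF assms(2,3,5)] assms(4) by simp

section \<open>Rotations seen after deleting a vertex\<close>

text \<open>Apart from \<open>n\<close>, the rotation changes only the tube of \<open>i\<close>, and
  its new value, the component of \<open>i\<close> in \<open>S i - {n}\<close>, is what deleting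
  \<open>n\<close> would have produced anyway.\<close>

lemma tube_del_rotate_up:
  assumes tub: "tubing E V S" and arc: "(i, n) \<in> arcs V S" and "u \<noteq> n"
  shows "tube_del E n (tube_rotate E S i n) u = tube_del E n S u"
proof (cases "u = i")
  case True
  have "i \<in> S i" "i \<noteq> n" using arcsD[OF tub arc] tubing_refl[OF tub] by auto
  then show ?thesis
    using True component_diff_component[of i "S i - {n}" "{n}" E]
    by (simp add: tube_del_def tube_rotate_simps)
qed (use assms(3) in \<open>simp add: tube_del_def tube_rotate_simps\<close>)

lemma tube_del_rotate_down:
  assumes tub: "tubing E V S" and arc: "(n, i) \<in> arcs V S" and "u \<noteq> n"
  shows "tube_del E n (tube_rotate E S n i) u = tube_del E n S u"
  using tube_del_rotate_up[OF tubing_tube_rotate[OF tub arc] rev_arc_tube_rotate[OF tub arc] assms(3)]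
    tube_rotate_tube_rotate[OF tub arc] by simp

text \<open>If \<open>i\<close> and \<open>j\<close> stay together in \<open>S i\<close> once
  \<open>n\<close> is gone, the rotation survives the deletion. Otherwise deleting \<open>n\<close>
  separates them, their relative order no longer matters, and the rotation projects to the
  identity.\<close>

lemma tube_del_rotate:
  assumes tub: "tubing E V S" and arc: "(i, j) \<in> arcs V S" and n: "i \<noteq> n" "j \<noteq> n"
  shows "if j \<in> tube_del E n S i
    then (i, j) \<in> arcs (V - {n}) (tube_del E n S) \<and>
      tube_del E n (tube_rotate E S i j) u = tube_rotate E (tube_del E n S) i j u
    else tube_del E n (tube_rotate E S i j) u = tube_del E n S u"
proof -
  note a = arcsD[OF tub arc]
  have iS: "i \<in> S i" using tubing_refl[OF tub a(1)] .
  let ?D = "tube_del E n S"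
  have sub: "?D v \<subseteq> S v" if "v \<in> V" "v \<noteq> n" for v
    unfolding tube_del_def using component_subset[of v "S v - {n}" E] tubing_refl[OF tub that(1)] that by blast
  have Di: "tube_del E n (tube_rotate E S i j) i = component E (S i - {n} - {j}) i"
    using component_diff_component[of i "S i - {j}" "{n}" E] iS a n
    by (simp add: tube_del_def tube_rotate_simps Diff_insert[symmetric] insert_commute)
  have Dj: "tube_del E n (tube_rotate E S i j) j = component E (S i - {n}) j"
    using a by (simp add: tube_del_def tube_rotate_simps)
  have Do: "tube_del E n (tube_rotate E S i j) u = ?D u" if "u \<noteq> i" "u \<noteq> j"
    using that by (simp add: tube_del_def tube_rotate_simps)
  show ?thesis
  proof (cases "j \<in> ?D i")
    case True
    have "(i, j) \<in> arcs (V - {n}) ?D"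
    proof -
      have "w = i \<or> w = j" if w: "w \<in> ?D i" "j \<in> ?D w" for w
      proof -
        have "w \<in> S i" "w \<noteq> n" "w \<in> V"
          using w(1) sub[OF a(1) n(1)] tubing_subset[OF tub a(1)]
            component_subset[of i "S i - {n}" E] iS n unfolding tube_del_def by blast+
        then show ?thesis using sub[of w] w a(7) by blast
      qed
      then show ?thesis unfolding arcs_def using True a n by auto
    qed
    moreover have "tube_del E n (tube_rotate E S i j) u = tube_rotate E ?D i j u"
    proof -
      consider "u = i" | "u = j" | "u \<noteq> i" "u \<noteq> j" by blast
      then show ?thesis
      proof cases
        case 1
        then show ?thesis using Di component_diff_component[of i "S i - {n}" "{j}" E] iS a n
          by (simp add: tube_rotate_simps) (simp add: tube_del_def)
      next
        case 2
        then show ?thesis using Dj a True component_eq[of j E "S i - {n}" i]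
          by (simp add: tube_rotate_simps) (simp add: tube_del_def)
      next
        case 3
        then show ?thesis using Do by (simp add: tube_rotate_simps)
      qed
    qed
    ultimately show ?thesis using True by simp
  next
    case False
    have "component E (S i - {n} - {j}) i = ?D i"
      unfolding tube_del_def
      by (rule component_absorb)
        (use False component_subset[of i "S i - {n}" E] iS n in \<open>auto simp: tube_del_def\<close>)
    moreover have "component E (S i - {n}) j = ?D j"
    proof -
      have jS: "j \<in> S i - {n}" using a n by blast
      have "i \<notin> component E (S i - {n}) j"
        using False component_eq component_refl unfolding tube_del_def by metis
      then have "component E (S i - {n} - {i}) j = component E (S i - {n}) j"
        by (intro component_absorb) (use component_subset[OF jS, of E] in auto)
      moreover have "component E (component E (S i - {i}) j - {n}) j = component E (S i - {i} - {n}) j"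
        by (rule component_diff_component) (use a n in auto)
      moreover have "S i - {n} - {i} = S i - {i} - {n}" by blast
      ultimately show ?thesis using arc_component[OF tub arc] by (simp add: tube_del_def)
    qed
    ultimately have "tube_del E n (tube_rotate E S i j) u = ?D u"
      using Di Dj Do by (cases "u = i"; cases "u = j") auto
    then show ?thesis using False by simp
  qed
qed

text \<open>A section of \<open>tube_del\<close>: it supplies the representative of each fibre in
  which \<open>n\<close> is the root of its component.\<close>

definition tube_top :: "'a set set \<Rightarrow> 'a set \<Rightarrow> 'a \<Rightarrow> ('a \<Rightarrow> 'a set) \<Rightarrow> 'a \<Rightarrow> 'a set" where
  "tube_top E V n S = S(n := component E V n)"

lemma tubing_tube_top:
  assumes "tubing E (V - {n}) S" "n \<in> V"
  shows "tubing E V (tube_top E V n S)"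
  using tubing_add_root[OF assms(1), of n "component E V n"] assms(2) component_subset[OF assms(2), of E]
  by (simp add: tube_top_def insert_absorb)

lemma tube_del_top:
  assumes "tubing E (V - {n}) S" "u \<in> V - {n}"
  shows "tube_del E n (tube_top E V n S) u = S u"
proof -
  have "S u - {n} = S u" using tubing_subset[OF assms] by blast
  then show ?thesis using tubing_connected[OF assms] assms(2)
    by (simp add: tube_del_def tube_top_def)
qed

section \<open>Simplicial vertices and components with at most three vertices\<close>

text \<open>A path through \<open>n\<close> can be shortened, because the neighbours of
  \<open>n\<close> before and after it are equal or adjacent.\<close>

lemma component_remove_simplicial:
  assumes "u \<in> A" "u \<noteq> n" "component E A u = A"
    and simp: "\<And>a b. a \<in> A \<Longrightarrow> b \<in> A \<Longrightarrow> a \<noteq> n \<Longrightarrow> b \<noteq> n \<Longrightarrow> a \<noteq> b \<Longrightarrow>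
      {n, a} \<in> E \<Longrightarrow> {n, b} \<in> E \<Longrightarrow> {a, b} \<in> E"
  shows "component E (A - {n}) u = A - {n}"
proof
  let ?K = "component E (A - {n}) u"
  show K: "?K \<subseteq> A - {n}" by (rule component_subset) (use assms in auto)
  \<comment> \<open>The vertex \<open>n\<close> joins the closed set only together with a neighbour
    \<open>k\<close> in \<open>?K\<close>; from \<open>n\<close> the walk then continues as if from
    \<open>k\<close>.\<close>
  have "component E A u \<subseteq> ?K \<union> {x. x = n \<and> (\<exists>k\<in>?K. {n, k} \<in> E)}"
  proof (rule component_closed)
    fix x y assume x: "x \<in> ?K \<union> {x. x = n \<and> (\<exists>k\<in>?K. {n, k} \<in> E)}" and xy: "x \<in> A" "y \<in> A" "{x, y} \<in> E"
    show "y \<in> ?K \<union> {x. x = n \<and> (\<exists>k\<in>?K. {n, k} \<in> E)}"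
    proof (cases "y = n")
      case True
      then show ?thesis using x xy by (auto simp: insert_commute)
    next
      case yn: False
      show ?thesis
      proof (cases "x = n")
        case True
        then obtain k where k: "k \<in> ?K" "{n, k} \<in> E" using x K by auto
        then have "k \<in> A - {n}" using K by blast
        then have "y = k \<or> {k, y} \<in> E" using simp[of k y] k xy True yn by auto
        then have "y \<in> ?K" using k component_step[of k E "A - {n}" u y] \<open>k \<in> A - {n}\<close> xy yn by auto
        then show ?thesis by simp
      next
        case False
        then have "x \<in> ?K" using x by simp
        then have "y \<in> ?K" using component_step[of x E "A - {n}" u y] xy yn False by simp
        then show ?thesis by simp
      qed
    qed
  qed simp
  then show "A - {n} \<subseteq> ?K" using assms(3) by auto
qed

text \<open>The bound 3 counts \<open>n\<close> and two non-adjacent neighbours: a fourth vertex is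
  what provides a parent for \<open>n\<close> in \<open>three_incident_arcs\<close>. It also leaves
  no room for a cycle of length four.\<close>

definition small_or_simplicial :: "'a set set \<Rightarrow> 'a set \<Rightarrow> 'a \<Rightarrow> bool" where
  "small_or_simplicial E V n \<longleftrightarrow> card (component E V n) \<le> 3 \<or>
     (\<forall>a\<in>V. \<forall>b\<in>V. a \<noteq> n \<longrightarrow> b \<noteq> n \<longrightarrow> a \<noteq> b \<longrightarrow> {n, a} \<in> E \<longrightarrow> {n, b} \<in> E \<longrightarrow> {a, b} \<in> E)"

definition incident :: "'a rel \<Rightarrow> 'a \<Rightarrow> 'a set" where
  "incident F n = {i. (i, n) \<in> F \<or> (n, i) \<in> F}"

text \<open>Let \<open>w\<close> lie strictly between \<open>i\<close> and \<open>j\<close> before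
  the deletion. If \<open>w = n\<close>, then \<open>n\<close> has both a parent and a child,
  contrary to \<open>inc\<close>. Otherwise deleting \<open>n\<close> must disconnect
  \<open>S i\<close> or \<open>S w\<close>: impossible if \<open>n\<close> is simplicial, and in a
  small component the four vertices \<open>i\<close>, \<open>w\<close>, \<open>j\<close>,
  \<open>n\<close> do not fit.\<close>

lemma arcs_tube_del_lift:
  assumes tub: "tubing E V S" and fin: "finite V" and n: "n \<in> V"
    and inc: "\<And>i i'. i \<in> incident (arcs V S) n \<Longrightarrow> i' \<in> incident (arcs V S) n \<Longrightarrow> i = i'"
    and small: "small_or_simplicial E V n"
    and arc: "(i, j) \<in> arcs (V - {n}) (tube_del E n S)"
  shows "(i, j) \<in> arcs V S"
proof -
  let ?D = "tube_del E n S"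
  note d = arcsD[OF tubing_tube_del[OF tub] arc]
  have V: "i \<in> V" "j \<in> V" "i \<noteq> n" "j \<noteq> n" using d by auto
  have iS: "i \<in> S i - {n}" using tubing_refl[OF tub V(1)] V by blast
  have jS: "j \<in> S i" using d(3) component_subset[OF iS, of E] by (auto simp: tube_del_def)
  have "w = i \<or> w = j" if w: "w \<in> S i" "j \<in> S w" for w
  proof (rule ccontr)
    assume *: "\<not> ?thesis"
    have wV: "w \<in> V" using w tubing_subset[OF tub V(1)] by blast
    have "w \<noteq> n"
    proof
      assume wn: "w = n"
      obtain p where p: "(p, n) \<in> arcs V S"
        using parent_exists(1)[OF tub fin V(1)] w(1) V wn by blast
      obtain q where q: "(n, q) \<in> arcs V S"
        using parent_exists(2)[OF tub fin n] w(2) V wn by blast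
      have "p = q" using inc p q by (simp add: incident_def)
      then show False using arcsD[OF tub p] arcsD[OF tub q] by blast
    qed
    have "\<not> (w \<in> ?D i \<and> j \<in> ?D w)" using d(7)[of w] * by blast
    moreover have "w \<in> S i - {n}" "j \<in> S w - {n}" using w \<open>w \<noteq> n\<close> V by auto
    ultimately have ne: "\<not> (?D i = S i - {n} \<and> ?D w = S w - {n})" by blast
    have D: "?D v = S v - {n}" if "n \<notin> S v" "v \<in> V" for v
      using tubing_connected[OF tub that(2)] that(1) by (simp add: tube_del_def)
    have nS: "n \<in> S i" using ne D[of i] D[of w] V wV tubing_trans[OF tub V(1) w(1)] by blast
    show False using small unfolding small_or_simplicial_def
    proof
      assume 3: "card (component E V n) \<le> 3"
      have "S i \<subseteq> component E V i" using tubing_subset_component[OF tub V(1)] .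
      moreover then have "component E V n = component E V i" using component_eq nS by (metis subsetD)
      ultimately have "{i, w, j, n} \<subseteq> component E V n" using iS w jS nS by auto
      moreover have "finite (component E V n)" using component_subset[OF n, of E] fin finite_subset by blast
      ultimately have "card {i, w, j, n} \<le> 3" using 3 card_mono[of "component E V n" "{i, w, j, n}"] by linarith
      moreover have "card {i, w, j, n} = 4" using * \<open>w \<noteq> n\<close> V d(4) by auto
      ultimately show False by simp
    next
      assume simp: "\<forall>a\<in>V. \<forall>b\<in>V. a \<noteq> n \<longrightarrow> b \<noteq> n \<longrightarrow> a \<noteq> b \<longrightarrow> {n, a} \<in> E \<longrightarrow> {n, b} \<in> E \<longrightarrow> {a, b} \<in> E"
      have "?D v = S v - {n}" if v: "v \<in> V" "v \<noteq> n" for v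
        unfolding tube_del_def
      proof (rule component_remove_simplicial)
        show "v \<in> S v" using tubing_refl[OF tub v(1)] .
        show "component E (S v) v = S v" using tubing_connected[OF tub v(1)] .
        fix a b assume "a \<in> S v" "b \<in> S v" "a \<noteq> n" "b \<noteq> n" "a \<noteq> b" "{n, a} \<in> E" "{n, b} \<in> E"
        moreover from this have "a \<in> V" "b \<in> V" using tubing_subset[OF tub v(1)] by auto
        ultimately show "{a, b} \<in> E" using simp by simp
      qed fact
      then show False using ne V wV \<open>w \<noteq> n\<close> by blast
    qed
  qed
  then show ?thesis unfolding arcs_def using V jS d(4) by auto
qed

section \<open>Forests obtained from elimination orders\<close>

text \<open>Eliminating vertices by increasing \<open>f\<close>, the tube of \<open>u\<close> is its
  component among the vertices not eliminated before it. This yields concrete forests without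
  building trees.\<close>

lemma tubing_of_order:
  assumes inj: "inj_on f V"
  shows "tubing E V (\<lambda>u. component E {w \<in> V. (f u :: nat) \<le> f w} u)"
proof (rule tubingI)
  let ?U = "\<lambda>u. {w \<in> V. f u \<le> f w}"
  let ?S = "\<lambda>u. component E (?U u) u"
  fix u assume u: "u \<in> V"
  have uU: "u \<in> ?U u" using u by simp
  show "u \<in> ?S u" by simp
  show "?S u \<subseteq> V" using component_subset[OF uU, of E] by blast
  show "component E (?S u) u = ?S u" using component_component[OF uU] .
  show "?S v \<subseteq> ?S u - {u}" if v: "v \<in> ?S u" "v \<noteq> u" for v
  proof -
    have vU: "v \<in> ?U u" using v component_subset[OF uU, of E] by blast
    then have "f u < f v" using inj v(2) u by (metis (mono_tags, lifting) mem_Collect_eq inj_onD le_neq_implies_less)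
    then have "?S v \<subseteq> component E (?U u) v" by (intro component_mono) auto
    moreover have "component E (?U u) v = ?S u" using component_eq[OF v(1)] .
    moreover have "u \<notin> ?S v" using component_subset[of v "?U v" E] vU \<open>f u < f v\<close> by auto
    ultimately show ?thesis by blast
  qed
  show "u \<in> ?S y" if x: "x \<in> ?S u" and y: "y \<in> V" "{x, y} \<in> E" "y \<notin> ?S u" for x y
  proof -
    have xU: "x \<in> ?U u" using x component_subset[OF uU, of E] by blast
    have "y \<notin> ?U u" using component_step[OF x xU] y by blast
    then have "?U u \<subseteq> ?U y" using y(1) by auto
    then have "x \<in> component E (?U y) u" using component_mono[of "?U u" "?U y" E u] x by blast
    moreover have "x \<in> ?U y" using \<open>?U u \<subseteq> ?U y\<close> xU by (rule subsetD)
    ultimately have "y \<in> component E (?U y) u" using component_step[of x E "?U y" u y] y by simp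
    then show ?thesis using component_eq component_refl by metis
  qed
qed

text \<open>Eliminate everything else first, then a fourth vertex \<open>c\<close> next to the path \<open>a, n, b\<close>, then \<open>n\<close>.\<close>

lemma three_incident_arcs:
  fixes V :: "nat set"
  assumes fin: "finite V" and n: "n \<in> V" and nsmall: "\<not> small_or_simplicial E V n"
  shows "\<exists>S a b c. tubing E V S \<and> {a, b, c} \<subseteq> incident (arcs V S) n \<and> a \<noteq> b \<and> a \<noteq> c \<and> b \<noteq> c"
proof -
  obtain a b where ab: "a \<in> V" "b \<in> V" "a \<noteq> n" "b \<noteq> n" "a \<noteq> b"
    and E: "{n, a} \<in> E" "{n, b} \<in> E" "{a, b} \<notin> E"
    using nsmall unfolding small_or_simplicial_def by blast
  have "\<not> component E V n \<subseteq> {n, a, b}"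
  proof
    assume "component E V n \<subseteq> {n, a, b}"
    then have "card (component E V n) \<le> card {n, a, b}" by (intro card_mono) auto
    also have "\<dots> \<le> 3" using ab by simp
    finally show False using nsmall by (simp add: small_or_simplicial_def)
  qed
  \<comment> \<open>Since the component of \<open>n\<close> is not contained in
    \<open>{n, a, b}\<close>, some edge leaves this set; its inner end \<open>z\<close> may be any
    of the three.\<close>
  then obtain z c where c: "c \<in> V" "c \<notin> {n, a, b}" and z: "z \<in> {n, a, b}" "{z, c} \<in> E"
    using component_closed[of n "{n, a, b}" V E] by blast
  define N where "N = Max V"
  have N: "w \<le> N" if "w \<in> V" for w using fin that by (simp add: N_def)
  \<comment> \<open>Values above \<open>Max V\<close> put these four last, while the other vertices
    keep their own numbers, so \<open>f\<close> is injective.\<close>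
  define f where "f w = (if w = c then N + 1 else if w = n then N + 2 else if w = a then N + 3
    else if w = b then N + 4 else w)" for w
  define S where "S u = component E {w \<in> V. f u \<le> f w} u" for u
  have "inj_on f V"
  proof (rule inj_onI)
    fix x y assume "x \<in> V" "y \<in> V" "f x = f y"
    then show "x = y" using N[of x] N[of y] by (auto simp: f_def split: if_splits)
  qed
  then have tub: "tubing E V S" unfolding S_def by (rule tubing_of_order)
  have f: "f c = N + 1" "f n = N + 2" "f a = N + 3" "f b = N + 4" using ab c by (auto simp: f_def)
  have f': "f w \<le> N" if "w \<in> V" "w \<notin> {a, b, c, n}" for w using that N by (auto simp: f_def)
  have U: "{w \<in> V. f c \<le> f w} = {c, n, a, b}" "{w \<in> V. f n \<le> f w} = {n, a, b}"
    "{w \<in> V. f a \<le> f w} = {a, b}" "{w \<in> V. f b \<le> f w} = {b}"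
  proof -
    have "w \<in> {a, b, c, n}" if "w \<in> V" "N < f w" for w using that f'[of w] by force
    then show "{w \<in> V. f c \<le> f w} = {c, n, a, b}" "{w \<in> V. f n \<le> f w} = {n, a, b}"
      "{w \<in> V. f a \<le> f w} = {a, b}" "{w \<in> V. f b \<le> f w} = {b}"
      using f ab(1,2) c(1) n by force+
  qed
  have Sb: "S b \<subseteq> {b}" unfolding S_def U using component_subset[of b "{b}" E] by simp
  \<comment> \<open>Here the missing edge between \<open>a\<close> and \<open>b\<close> enters:
    \<open>b\<close> does not end up below \<open>a\<close>, so both become children of
    \<open>n\<close>.\<close>
  have Sa: "S a \<subseteq> {a}" unfolding S_def U by (rule component_closed) (use E in \<open>auto simp: insert_commute\<close>)
  have Sn: "S n \<subseteq> {n, a, b}" unfolding S_def U using component_subset[of n "{n, a, b}" E] by simp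
  have Sc: "S c \<subseteq> {c, n, a, b}" unfolding S_def U using component_subset[of c "{c, n, a, b}" E] by simp
  have an: "a \<in> S n" "b \<in> S n" unfolding S_def U using E component_step[of n E "{n, a, b}" n] by auto
  have nc: "n \<in> S c"
  proof -
    have "z \<in> S c" unfolding S_def U using z component_step[of c E "{c, n, a, b}" c z] by (auto simp: insert_commute)
    then show ?thesis unfolding S_def U using z E component_step[of z E "{c, n, a, b}" c n]
      by (auto simp: insert_commute)
  qed
  have "(n, a) \<in> arcs V S" "(n, b) \<in> arcs V S" "(c, n) \<in> arcs V S"
    unfolding arcs_def using n c ab an nc Sa Sb Sn Sc by auto
  then have "{a, b, c} \<subseteq> incident (arcs V S) n" by (simp add: incident_def)
  moreover have "a \<noteq> b" "a \<noteq> c" "b \<noteq> c" using ab c by auto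
  ultimately show ?thesis using tub by blast
qed

section \<open>Runs of Algorithm R\<close>

definition level_rotations :: "nat set set \<Rightarrow> nat rel \<Rightarrow> nat \<Rightarrow> (nat \<times> nat rel) set" where
  "level_rotations E F j = up_rotations E F j \<union> down_rotations E F j"

lemma new_rotations_iff:
  "(i, F') \<in> new_rotations E Fs j \<longleftrightarrow> (i, F') \<in> level_rotations E (last Fs) j \<and> F' \<notin> set Fs"
  by (simp add: new_rotations_def level_rotations_def)

lemma elim_forestE:
  assumes "finite V" "elim_forest V E F"
  obtains S where "tubing E V S" "F = arcs V S"
  using assms elim_forest_iff_tubing by blast

lemma level_rotations_arcsI:
  assumes "tubing E V S" "finite V" "i < j" "a = i \<and> b = j \<or> a = j \<and> b = i" "(a, b) \<in> arcs V S"
  shows "(i, arcs V (tube_rotate E S a b)) \<in> level_rotations E (arcs V S) j"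
  using rotation_arcs[OF assms(1,5,2)] assms(3-5)
  unfolding level_rotations_def up_rotations_def down_rotations_def by auto

lemma level_rotations_arcsE:
  assumes "tubing E V S" "finite V" "(i, F') \<in> level_rotations E (arcs V S) j"
  obtains a b where "i < j" "a = i \<and> b = j \<or> a = j \<and> b = i" "(a, b) \<in> arcs V S"
    "F' = arcs V (tube_rotate E S a b)"
proof -
  consider "i < j" "(i, j) \<in> arcs V S" "F' = rotation E (arcs V S) i j"
    | "i < j" "(j, i) \<in> arcs V S" "F' = rotation E (arcs V S) j i"
    using assms(3) unfolding level_rotations_def up_rotations_def down_rotations_def by auto
  then show thesis
    using rotation_arcs[OF assms(1) _ assms(2)] that[of i j] that[of j i] by cases auto
qed

text \<open>An up-rotation of \<open>j\<close> is undone by a down-rotation of the same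
  \<open>j\<close> along the same edge, so level \<open>j\<close> and index \<open>i\<close> are
  preserved.\<close>

lemma level_rotations_sym:
  assumes fin: "finite V" and F: "elim_forest V E F" and F': "(i, F') \<in> level_rotations E F j"
  shows "elim_forest V E F'" "(i, F) \<in> level_rotations E F' j" "F' \<noteq> F" "j \<in> V" "i \<in> V"
proof -
  obtain S where S: "tubing E V S" "F = arcs V S" by (rule elim_forestE[OF fin F])
  obtain a b where ab: "i < j" "a = i \<and> b = j \<or> a = j \<and> b = i" "(a, b) \<in> arcs V S"
      "F' = arcs V (tube_rotate E S a b)"
    using level_rotations_arcsE[OF S(1) fin] F' S(2) by metis
  note t = tubing_tube_rotate[OF S(1) ab(3)] and r = rev_arc_tube_rotate[OF S(1) ab(3)]
  show "elim_forest V E F'" using elim_forest_arcs[OF t fin] ab(4) by simp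
  show "(i, F) \<in> level_rotations E F' j"
    using level_rotations_arcsI[OF t fin ab(1) _ r] ab(2,4) tube_rotate_tube_rotate[OF S(1) ab(3)] S(2)
    by auto
  show "F' \<noteq> F" using r ab(4) S(2) arcsD(3)[OF S(1), of b a] arcsD(5)[OF S(1) ab(3)] by auto
  show "j \<in> V" "i \<in> V" using ab(2) arcsD[OF S(1) ab(3)] by auto
qed

lemma finite_level_rotations: "finite (level_rotations E F j)"
proof -
  have "level_rotations E F j \<subseteq> (\<lambda>i. (i, rotation E F i j)) ` {..<j} \<union> (\<lambda>i. (i, rotation E F j i)) ` {..<j}"
    by (auto simp: level_rotations_def up_rotations_def down_rotations_def)
  then show ?thesis by (rule finite_subset) simp
qed

text \<open>Trades \<open>Max\<close> and \<open>the_elem\<close> for a condition that can be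
  checked level by level. The maximum is meaningful because levels with a rotation are vertices of
  the finite set \<open>V\<close>.\<close>

lemma alg_R_next_eq_Some_iff:
  assumes fin: "finite V" and F: "elim_forest V E (last Fs)"
  shows "alg_R_next E Fs = Some F' \<longleftrightarrow>
    (\<exists>j i. new_rotations E Fs j = {(i, F')} \<and> (\<forall>k>j. new_rotations E Fs k = {}))"
proof -
  define J where "J = {j. new_rotations E Fs j \<noteq> {}}"
  have "J \<subseteq> V"
  proof
    fix j assume "j \<in> J"
    then obtain i G where "(i, G) \<in> new_rotations E Fs j" unfolding J_def by fast
    then show "j \<in> V" using level_rotations_sym(4)[OF fin F] new_rotations_iff by blast
  qed
  then have finJ: "finite J" using fin finite_subset by blast
  have finN: "finite (new_rotations E Fs j)" for j
    by (rule finite_subset[OF _ finite_level_rotations[of E "last Fs" j]])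
      (auto simp: new_rotations_def level_rotations_def)
  have next_eq: "alg_R_next E Fs = (if J = {} \<or> card (new_rotations E Fs (Max J)) > 1 then None
    else Some (snd (the_elem (new_rotations E Fs (Max J)))))"
    by (simp add: alg_R_next_def J_def Let_def)
  show ?thesis
  proof
    assume "alg_R_next E Fs = Some F'"
    then have J: "J \<noteq> {}" and card: "card (new_rotations E Fs (Max J)) \<le> 1"
      and F': "F' = snd (the_elem (new_rotations E Fs (Max J)))"
      unfolding next_eq by (auto split: if_splits)
    have "new_rotations E Fs (Max J) \<noteq> {}" using Max_in[OF finJ J] by (simp add: J_def)
    then have "card (new_rotations E Fs (Max J)) = 1" using card finN by (simp add: le_Suc_eq)
    then obtain p where p: "new_rotations E Fs (Max J) = {p}" by (rule card_1_singletonE)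
    then have "p = (fst p, F')" using F' by simp
    then have "new_rotations E Fs (Max J) = {(fst p, F')}" using p by simp
    moreover have "new_rotations E Fs k = {}" if "k > Max J" for k
      using Max_ge[OF finJ, of k] that by (auto simp: J_def)
    ultimately show "\<exists>j i. new_rotations E Fs j = {(i, F')} \<and> (\<forall>k>j. new_rotations E Fs k = {})" by blast
  next
    assume "\<exists>j i. new_rotations E Fs j = {(i, F')} \<and> (\<forall>k>j. new_rotations E Fs k = {})"
    then obtain j i where j: "new_rotations E Fs j = {(i, F')}" "\<And>k. k > j \<Longrightarrow> new_rotations E Fs k = {}"
      by blast
    have jJ: "j \<in> J" using j by (simp add: J_def)
    have "Max J = j" using finJ _ jJ
    proof (rule Max_eqI)
      fix k assume "k \<in> J"
      then show "k \<le> j" using j(2)[of k] by (force simp: J_def)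
    qed
    then show "alg_R_next E Fs = Some F'" unfolding next_eq using j(1) jJ by auto
  qed
qed

text \<open>Turns the inductive run into an indexed one: each entry is the choice of the algorithm
  on the prefix before it.\<close>

lemma alg_R_visits_invariants:
  assumes fin: "finite V" and F0: "elim_forest V E F0"
  shows "alg_R_visits E F0 Fs \<Longrightarrow> Fs \<noteq> [] \<and> Fs ! 0 = F0 \<and> distinct Fs \<and> (\<forall>F\<in>set Fs. elim_forest V E F) \<and>
    (\<forall>t. Suc t < length Fs \<longrightarrow> alg_R_next E (take (Suc t) Fs) = Some (Fs ! Suc t))"
proof (induction rule: alg_R_visits.induct)
  case start
  then show ?case using F0 by simp
next
  case (visit Fs F)
  then have ne: "Fs \<noteq> []" and last: "elim_forest V E (last Fs)" by auto
  obtain j i where "new_rotations E Fs j = {(i, F)}"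
    using visit.hyps(2) alg_R_next_eq_Some_iff[OF fin last] by blast
  then have "(i, F) \<in> level_rotations E (last Fs) j" "F \<notin> set Fs"
    using new_rotations_iff[of i F E Fs j] by auto
  then have "elim_forest V E F" "F \<notin> set Fs" using level_rotations_sym[OF fin last] by auto
  then show ?case using visit ne by (auto simp: nth_append less_Suc_eq)
qed

lemma alg_R_terminates:
  assumes fin: "finite V" and F0: "elim_forest V E F0"
  shows "\<exists>Fs. alg_R_terminates_with E F0 Fs"
proof (rule ccontr)
  assume "\<not> ?thesis"
  then have cont: "\<exists>F. alg_R_next E Fs = Some F" if "alg_R_visits E F0 Fs" for Fs
    using that by (auto simp: alg_R_terminates_with_def)
  have "\<exists>Fs. alg_R_visits E F0 Fs \<and> length Fs = Suc m" for m
  proof (induction m)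
    case 0 then show ?case using alg_R_visits.start by fastforce
  next
    case (Suc m)
    then obtain Fs where Fs: "alg_R_visits E F0 Fs" "length Fs = Suc m" by blast
    obtain F where "alg_R_next E Fs = Some F" using cont Fs by blast
    then have "alg_R_visits E F0 (Fs @ [F])" using alg_R_visits.visit Fs by blast
    then show ?case using Fs by fastforce
  qed
  \<comment> \<open>Visited forests are distinct subsets of \<open>V \<times> V\<close>, so a run of
    this length is one too long.\<close>
  then obtain Fs where Fs: "alg_R_visits E F0 Fs" "length Fs = Suc (card (Pow (V \<times> V)))" by blast
  note inv = alg_R_visits_invariants[OF fin F0 Fs(1)]
  have "set Fs \<subseteq> Pow (V \<times> V)"
  proof
    fix F assume "F \<in> set Fs"
    then have "elim_forest V E F" using inv by blast
    then obtain S where "tubing E V S" "F = arcs V S" by (rule elim_forestE[OF fin])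
    then show "F \<in> Pow (V \<times> V)" using arcs_subset by auto
  qed
  then have "card (set Fs) \<le> card (Pow (V \<times> V))" using fin by (intro card_mono) auto
  then show False using inv Fs(2) distinct_card by fastforce
qed

section \<open>Runs that visit every elimination forest\<close>

text \<open>The assumption to be refuted for non-chordal graphs, with \<open>n\<close> the largest
  vertex and therefore the level with top priority.\<close>

locale exhaustive_run =
  fixes E :: "nat set set" and V :: "nat set" and F0 :: "nat rel" and Fs :: "nat rel list" and n :: nat
  assumes fin: "finite V" and F0: "elim_forest V E F0" and run: "alg_R_visits E F0 Fs"
    and all: "\<And>F. elim_forest V E F \<Longrightarrow> F \<in> set Fs"
    and n: "n \<in> V" and n_max: "\<And>v. v \<in> V \<Longrightarrow> v \<le> n"
begin

lemmas inv = alg_R_visits_invariants[OF fin F0 run]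

lemma forest_nth: "t < length Fs \<Longrightarrow> elim_forest V E (Fs ! t)"
  using inv by simp

lemma last_take: "t < length Fs \<Longrightarrow> last (take (Suc t) Fs) = Fs ! t"
  by (simp add: take_Suc_conv_app_nth)

lemma step:
  assumes "Suc t < length Fs"
  shows "\<exists>j i. new_rotations E (take (Suc t) Fs) j = {(i, Fs ! Suc t)} \<and>
    (\<forall>k>j. new_rotations E (take (Suc t) Fs) k = {})"
proof -
  have "elim_forest V E (last (take (Suc t) Fs))" using last_take forest_nth assms by simp
  then show ?thesis using alg_R_next_eq_Some_iff[OF fin] inv assms by blast
qed

lemma not_visited_before: "t < length Fs \<Longrightarrow> s < t \<Longrightarrow> Fs ! t \<notin> set (take (Suc s) Fs)"
  using inv by (auto simp: in_set_conv_nth nth_eq_iff_index_eq)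

text \<open>No level lies above \<open>n\<close>, so an available rotation at \<open>n\<close> must
  be taken; as the run does not stop there, it is also the only one.\<close>

lemma level_n_step:
  assumes "Suc s < length Fs" "(i, F) \<in> new_rotations E (take (Suc s) Fs) n"
  shows "new_rotations E (take (Suc s) Fs) n = {(i, F)}" "F = Fs ! Suc s"
proof -
  obtain j k where j: "new_rotations E (take (Suc s) Fs) j = {(k, Fs ! Suc s)}"
    "\<And>k. k > j \<Longrightarrow> new_rotations E (take (Suc s) Fs) k = {}" using step[OF assms(1)] by blast
  have "(k, Fs ! Suc s) \<in> level_rotations E (Fs ! s) j"
    using j(1) new_rotations_iff[of k _ E "take (Suc s) Fs" j] last_take assms by fastforce
  then have "j \<in> V" using level_rotations_sym(4)[OF fin forest_nth] assms(1) Suc_lessD by blast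
  then have "j \<le> n" using n_max by blast
  moreover have "\<not> n > j" using j(2) assms(2) by blast
  ultimately have "j = n" by simp
  then show "new_rotations E (take (Suc s) Fs) n = {(i, F)}" "F = Fs ! Suc s"
    using j(1) assms(2) by auto
qed

lemma later_level_n:
  assumes "s < t" "t < length Fs" "(i, Fs ! t) \<in> level_rotations E (Fs ! s) n"
  shows "new_rotations E (take (Suc s) Fs) n = {(i, Fs ! t)}" "t = Suc s"
proof -
  have *: "Suc s < length Fs" using assms by simp
  have new: "(i, Fs ! t) \<in> new_rotations E (take (Suc s) Fs) n"
    using new_rotations_iff not_visited_before last_take assms by simp
  show "new_rotations E (take (Suc s) Fs) n = {(i, Fs ! t)}" using level_n_step(1)[OF * new] .
  have "Fs ! t = Fs ! Suc s" using level_n_step(2)[OF * new] .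
  then show "t = Suc s" using inv assms * by (simp add: nth_eq_iff_index_eq)
qed

lemma incident_rotation:
  assumes "elim_forest V E F" "i \<in> incident F n"
  shows "\<exists>F'. (i, F') \<in> level_rotations E F n"
proof -
  obtain S where S: "tubing E V S" "F = arcs V S" by (rule elim_forestE[OF fin assms(1)])
  have "i \<in> V" "i \<noteq> n" using assms(2) arcsD[OF S(1)] unfolding incident_def S(2) by blast+
  then have "i < n" using n_max by (simp add: order_less_le)
  then show ?thesis
    using assms(2) level_rotations_arcsI[OF S(1) fin, of i n] unfolding incident_def S(2) by blast
qed

text \<open>The forest obtained by rotating the edge at \<open>i\<close> is visited somewhere: if
  later, it comes next; if earlier, it came just before. The singletons are stated so that each
  alternative determines \<open>i\<close>.\<close>

lemma incident_neighbour:
  assumes "s < length Fs" "i \<in> incident (Fs ! s) n"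
  shows "Suc s < length Fs \<and> new_rotations E (take (Suc s) Fs) n = {(i, Fs ! Suc s)} \<or>
    0 < s \<and> new_rotations E (take s Fs) n = {(i, Fs ! s)}"
proof -
  obtain F' where F': "(i, F') \<in> level_rotations E (Fs ! s) n"
    using incident_rotation[OF forest_nth] assms by blast
  note sym = level_rotations_sym[OF fin forest_nth[OF assms(1)] F']
  obtain t where t: "t < length Fs" "F' = Fs ! t" using all[OF sym(1)] by (auto simp: in_set_conv_nth)
  then have "t \<noteq> s" using sym(3) by blast
  then show ?thesis
  proof (cases "s < t")
    case True
    then show ?thesis using later_level_n[OF True t(1)] F' t by auto
  next
    case False
    then have "t < s" using \<open>t \<noteq> s\<close> by simp
    then show ?thesis using later_level_n[OF \<open>t < s\<close> assms(1)] sym(2) t by auto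
  qed
qed

lemma no_three_incident:
  assumes F: "elim_forest V E F" and "{a, b, c} \<subseteq> incident F n" "a \<noteq> b" "a \<noteq> c" "b \<noteq> c"
  shows False
proof -
  obtain s where s: "s < length Fs" "F = Fs ! s" using all[OF F] by (auto simp: in_set_conv_nth)
  \<comment> \<open>Each of \<open>?P\<close> and \<open>?Q\<close> holds for at most one index, so
    together they cannot cover three.\<close>
  let ?P = "\<lambda>i. new_rotations E (take (Suc s) Fs) n = {(i, Fs ! Suc s)}"
  let ?Q = "\<lambda>i. new_rotations E (take s Fs) n = {(i, Fs ! s)}"
  have "?P i \<or> ?Q i" if "i \<in> {a, b, c}" for i
    using incident_neighbour[OF s(1), of i] that assms(2) s(2) by blast
  then have "?P a \<or> ?Q a" "?P b \<or> ?Q b" "?P c \<or> ?Q c" by auto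
  then show False using assms(3-5) by auto
qed

lemma small_or_simplicial: "small_or_simplicial E V n"
proof (rule ccontr)
  assume "\<not> ?thesis"
  then obtain S a b c where S: "tubing E V S"
    and abc: "{a, b, c} \<subseteq> incident (arcs V S) n" "a \<noteq> b" "a \<noteq> c" "b \<noteq> c"
    using three_incident_arcs[OF fin n] by blast
  show False by (rule no_three_incident[OF elim_forest_arcs[OF S fin] abc])
qed

section \<open>Fibres of the deletion map\<close>

abbreviation P :: "nat rel \<Rightarrow> nat rel" where
  "P \<equiv> forest_del E V n"

definition link :: "nat rel rel" where
  "link = {(F, F'). elim_forest V E F \<and> (\<exists>i. (i, F') \<in> level_rotations E F n)}"

lemma sym_link: "sym link"
proof (rule symI)
  fix F F' assume "(F, F') \<in> link"
  then obtain i where "elim_forest V E F" "(i, F') \<in> level_rotations E F n"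
    by (auto simp: link_def)
  from level_rotations_sym(1,2)[OF fin this] show "(F', F) \<in> link" by (auto simp: link_def)
qed

lemma link_forest_del:
  assumes "(F, F') \<in> link"
  shows "P F' = P F"
proof -
  obtain i where F: "elim_forest V E F" and F': "(i, F') \<in> level_rotations E F n"
    using assms by (auto simp: link_def)
  obtain S where S: "tubing E V S" "F = arcs V S" by (rule elim_forestE[OF fin F])
  obtain a b where ab: "a = i \<and> b = n \<or> a = n \<and> b = i" "(a, b) \<in> arcs V S"
      "F' = arcs V (tube_rotate E S a b)"
    using level_rotations_arcsE[OF S(1) fin] F' S(2) by metis
  note t = tubing_tube_rotate[OF S(1) ab(2)]
  have "arcs (V - {n}) (tube_del E n (tube_rotate E S a b)) = arcs (V - {n}) (tube_del E n S)"
  proof (rule arcs_cong)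
    fix u assume u: "u \<in> V - {n}"
    show "tube_del E n (tube_rotate E S a b) u = tube_del E n S u"
      using ab(1,2) u tube_del_rotate_up[OF S(1)] tube_del_rotate_down[OF S(1)] by auto
    show "tube_del E n (tube_rotate E S a b) u \<subseteq> V - {n}"
      using tubing_subset[OF tubing_tube_del[OF t] u] .
  qed
  then show ?thesis using forest_del_arcs[OF S(1) fin] forest_del_arcs[OF t fin] ab(3) S(2) by simp
qed

text \<open>Rotating \<open>n\<close> upwards until it becomes a root does not leave the fibre of \<^const>\<open>forest_del\<close>.\<close>

lemma link_tube_top:
  assumes "tubing E V S"
  shows "(arcs V S, arcs V (tube_top E V n (tube_del E n S))) \<in> link\<^sup>*"
  using assms
\<comment> \<open>An up-rotation of \<open>n\<close> enlarges its tube from \<open>S n\<close> to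
  \<open>S i\<close>, so this measure drops.\<close>
proof (induction "card V - card (S n)" arbitrary: S rule: less_induct)
  case less
  note tub = less.prems
  show ?case
  proof (cases "S n = component E V n")
    case True
    have "arcs V S = arcs V (tube_top E V n (tube_del E n S))"
    proof (rule arcs_cong)
      fix u assume u: "u \<in> V"
      show "S u \<subseteq> V" using tubing_subset[OF tub u] .
      show "S u = tube_top E V n (tube_del E n S) u"
      proof (cases "u = n")
        case True then show ?thesis using \<open>S n = component E V n\<close> by (simp add: tube_top_def)
      next
        case False
        have "n \<notin> S u"
        proof
          assume nu: "n \<in> S u"
          then have "component E V n = component E V u"
            using tubing_subset_component[OF tub u] component_eq by (metis subsetD)
          then have "u \<in> S n" using True component_refl by metis
          then show False using tubing_antisym[OF tub u nu] False by blast
        qed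
        then show ?thesis using tubing_connected[OF tub u] False by (simp add: tube_top_def tube_del_def)
      qed
    qed
    then show ?thesis by simp
  next
    case False
    have "\<exists>y\<in>V. n \<in> S y \<and> y \<noteq> n"
    proof (rule ccontr)
      assume no: "\<not> ?thesis"
      have "component E V n \<subseteq> S n"
      proof (rule component_closed)
        show "n \<in> S n" using tubing_refl[OF tub n] .
        fix x y assume "x \<in> S n" "x \<in> V" "y \<in> V" "{x, y} \<in> E"
        then show "y \<in> S n" using tubing_edge[OF tub n] no tubing_refl[OF tub n] by blast
      qed
      then show False using False tubing_subset_component[OF tub n] by blast
    qed
    then obtain i where i: "(i, n) \<in> arcs V S" using parent_exists(1)[OF tub fin] by blast
    note a = arcsD[OF tub i]
    let ?S = "tube_rotate E S i n"
    have t: "tubing E V ?S" using tubing_tube_rotate[OF tub i] .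
    have "i < n" using n_max[OF a(1)] a(4) by simp
    then have "(arcs V S, arcs V ?S) \<in> link"
      unfolding link_def using elim_forest_arcs[OF tub fin] level_rotations_arcsI[OF tub fin _ _ i, of i n] by blast
    moreover have "(arcs V ?S, arcs V (tube_top E V n (tube_del E n ?S))) \<in> link\<^sup>*"
    proof (rule less.hyps[OF _ t])
      have "S n \<subset> S i" using a(6) tubing_refl[OF tub a(1)] by blast
      moreover have "S i \<subseteq> V" using tubing_subset[OF tub a(1)] .
      ultimately have "card (S n) < card (S i)" "card (S i) \<le> card V"
        using fin by (auto intro: psubset_card_mono card_mono finite_subset)
      then show "card V - card (?S n) < card V - card (S n)" using a(4) by (simp add: tube_rotate_simps)
    qed
    moreover have "tube_top E V n (tube_del E n ?S) = tube_top E V n (tube_del E n S)"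
      using tube_del_rotate_up[OF tub i] by (simp add: tube_top_def fun_eq_iff)
    ultimately show ?thesis by (metis converse_rtrancl_into_rtrancl)
  qed
qed

text \<open>Both forests are linked to the same forest with \<open>n\<close> on top, which depends
  only on the common projection.\<close>

lemma fibre_linked:
  assumes "elim_forest V E F" "elim_forest V E F'" "P F = P F'"
  shows "(F, F') \<in> link\<^sup>*"
proof -
  obtain S where S: "tubing E V S" "F = arcs V S" by (rule elim_forestE[OF fin assms(1)])
  obtain S' where S': "tubing E V S'" "F' = arcs V S'" by (rule elim_forestE[OF fin assms(2)])
  note d = tubing_tube_del[OF S(1), of n] and d' = tubing_tube_del[OF S'(1), of n]
  have "arcs (V - {n}) (tube_del E n S) = arcs (V - {n}) (tube_del E n S')"
    using forest_del_arcs[OF S(1) fin] forest_del_arcs[OF S'(1) fin] assms(3) S(2) S'(2) by simp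
  then have eq: "tube_del E n S u = tube_del E n S' u" if "u \<in> V - {n}" for u
    using arcs_inject[OF d d'] fin that by blast
  have "arcs V (tube_top E V n (tube_del E n S)) = arcs V (tube_top E V n (tube_del E n S'))"
    by (rule arcs_cong)
      (use eq tubing_subset[OF tubing_tube_top[OF d n]] in \<open>auto simp: tube_top_def\<close>)
  then have "(F, arcs V (tube_top E V n (tube_del E n S'))) \<in> link\<^sup>*"
    using link_tube_top[OF S(1)] S(2) by simp
  moreover have "(arcs V (tube_top E V n (tube_del E n S')), F') \<in> link\<^sup>*"
    using link_tube_top[OF S'(1)] S'(2) sym_rtrancl[OF sym_link] by (auto dest: symD)
  ultimately show ?thesis by (rule rtrancl_trans)
qed

text \<open>Follow links from \<open>F\<close> to \<open>F'\<close>. The first link from a visited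
  forest to one not visited by time \<open>t\<close> would have to be the step from \<open>t\<close>
  to \<open>Suc t\<close>, but that step changes the fibre and links do not.\<close>

lemma fibre_contiguous:
  assumes t: "Suc t < length Fs" "P (Fs ! Suc t) \<noteq> P (Fs ! t)"
    and F: "F \<in> set (take (Suc t) Fs)" "elim_forest V E F'" "P F = P F'"
  shows "F' \<in> set (take (Suc t) Fs)"
proof -
  have "elim_forest V E F" using F(1) inv in_set_takeD by fast
  then have "(F, F') \<in> link\<^sup>*" using fibre_linked F by blast
  then show ?thesis using F(1)
  proof (induction rule: rtrancl_induct)
    case (step Y Z)
    obtain x where x: "x \<le> t" "Y = Fs ! x" 
      using step.IH F(1) t(1) by (auto simp: in_set_conv_nth less_Suc_eq_le)
    obtain i where i: "(i, Z) \<in> level_rotations E Y n" "elim_forest V E Y"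
      using step by (auto simp: link_def)
    obtain y where y: "y < length Fs" "Z = Fs ! y"
      using all[OF level_rotations_sym(1)[OF fin i(2,1)]] by (auto simp: in_set_conv_nth)
    show ?case
    proof (cases "y \<le> t")
      case True
      then show ?thesis using y by (auto simp: in_set_conv_nth intro!: exI[of _ y])
    next
      case False
      then have "y = Suc x" using later_level_n(2)[of x y i] i x y by simp
      then have "x = t" "y = Suc t" using False x by auto
      then show ?thesis using link_forest_del[OF step.hyps(2)] t(2) x y by simp
    qed
  qed
qed

lemma forest_del_forest:
  assumes F: "elim_forest V E F"
  shows "elim_forest (V - {n}) E (P F)"
proof -
  obtain S where S: "tubing E V S" "F = arcs V S" by (rule elim_forestE[OF fin F])
  then show ?thesis using elim_forest_arcs[OF tubing_tube_del[OF S(1)]] forest_del_arcs[OF S(1) fin] fin by simp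
qed

lemma forest_del_surj:
  assumes "elim_forest (V - {n}) E X"
  shows "\<exists>F. elim_forest V E F \<and> P F = X"
proof -
  obtain S where S: "tubing E (V - {n}) S" "X = arcs (V - {n}) S"
    using elim_forestE[OF _ assms] fin by blast
  note t = tubing_tube_top[OF S(1) n]
  have "arcs (V - {n}) S = arcs (V - {n}) (tube_del E n (tube_top E V n S))"
    by (rule arcs_cong) (use tube_del_top[OF S(1)] tubing_subset[OF S(1)] in auto)
  then show ?thesis using forest_del_arcs[OF t fin] elim_forest_arcs[OF t fin] S(2) by metis
qed

text \<open>Of the two outcomes in \<open>tube_del_rotate\<close>, the change of fibre rules out the
  identity. The index \<open>i\<close> is kept, so rotations can be compared edge by edge.\<close>

lemma forest_del_rotation:
  assumes F: "elim_forest V E F" and F': "(i, F') \<in> level_rotations E F j" and "j \<noteq> n" "P F' \<noteq> P F"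
  shows "(i, P F') \<in> level_rotations E (P F) j"
proof -
  obtain S where S: "tubing E V S" "F = arcs V S" by (rule elim_forestE[OF fin F])
  obtain a b where ab: "i < j" "a = i \<and> b = j \<or> a = j \<and> b = i" "(a, b) \<in> arcs V S"
      "F' = arcs V (tube_rotate E S a b)"
    using level_rotations_arcsE[OF S(1) fin] F' S(2) by metis
  have "j \<in> V" using level_rotations_sym(4)[OF fin F F'] .
  then have "a \<noteq> n" "b \<noteq> n" using ab(1,2) assms(3) n_max[of j] by auto
  note rot = tube_del_rotate[OF S(1) ab(3) this]
  note t = tubing_tube_rotate[OF S(1) ab(3)]
  note d = tubing_tube_del[OF S(1), of n] and d' = tubing_tube_del[OF t, of n]
  have PF: "P F = arcs (V - {n}) (tube_del E n S)" using forest_del_arcs[OF S(1) fin] S(2) by simp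
  have PF': "P F' = arcs (V - {n}) (tube_del E n (tube_rotate E S a b))"
    using forest_del_arcs[OF t fin] ab(4) by simp
  have *: "b \<in> tube_del E n S a"
  proof (rule ccontr)
    assume "b \<notin> tube_del E n S a"
    then have "tube_del E n (tube_rotate E S a b) = tube_del E n S" using rot by auto
    then show False using PF PF' assms(4) by simp
  qed
  then have "tube_del E n (tube_rotate E S a b) = tube_rotate E (tube_del E n S) a b" using rot by auto
  moreover have "(a, b) \<in> arcs (V - {n}) (tube_del E n S)" using rot * by simp
  ultimately show ?thesis
    unfolding PF PF' using level_rotations_arcsI[OF d _ ab(1,2)] fin by simp
qed

text \<open>Guards against extra choices downstairs: a competing edge or a higher level available in
  the projection would already be available in \<open>F\<close>.\<close>

lemma forest_del_rotation_lift:
  assumes F: "elim_forest V E F"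
    and inc: "\<And>i i'. i \<in> incident F n \<Longrightarrow> i' \<in> incident F n \<Longrightarrow> i = i'"
    and X: "(i, X) \<in> level_rotations E (P F) j"
  shows "\<exists>F'. (i, F') \<in> level_rotations E F j \<and> P F' = X"
proof -
  obtain S where S: "tubing E V S" "F = arcs V S" by (rule elim_forestE[OF fin F])
  note d = tubing_tube_del[OF S(1), of n]
  have PF: "P F = arcs (V - {n}) (tube_del E n S)" using forest_del_arcs[OF S(1) fin] S(2) by simp
  obtain a b where ab: "i < j" "a = i \<and> b = j \<or> a = j \<and> b = i"
      "(a, b) \<in> arcs (V - {n}) (tube_del E n S)"
      "X = arcs (V - {n}) (tube_rotate E (tube_del E n S) a b)"
    using level_rotations_arcsE[OF d _ X[unfolded PF]] fin by blast
  have arc: "(a, b) \<in> arcs V S"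
    using arcs_tube_del_lift[OF S(1) fin n _ small_or_simplicial ab(3)] inc S(2) by blast
  have nab: "a \<noteq> n" "b \<noteq> n" using arcsD[OF d ab(3)] by auto
  note t = tubing_tube_rotate[OF S(1) arc]
  have "tube_del E n (tube_rotate E S a b) = tube_rotate E (tube_del E n S) a b"
    using tube_del_rotate[OF S(1) arc nab] arcsD(3)[OF d ab(3)] by auto
  then have "P (arcs V (tube_rotate E S a b)) = X" using forest_del_arcs[OF t fin] ab(4) by simp
  then show ?thesis using level_rotations_arcsI[OF S(1) fin ab(1,2) arc] S(2) by blast
qed

text \<open>
  A fibre of the projection is left only at a forest where \<open>n\<close> has at most one incident
  arc, and there the rotations below level \<open>n\<close> leading to new fibres are exactly the new
  rotations of the projected forest.
\<close>

lemma projected_run: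
  "t < length Fs \<Longrightarrow> alg_R_visits E (P F0) (remdups_adj (map P (take (Suc t) Fs)))"
proof (induction t)
  case 0
  then show ?case using inv alg_R_visits.start by (cases Fs) auto
next
  case (Suc t)
  let ?A = "take (Suc t) Fs"
  \<comment> \<open>A stay inside one fibre collapses to a single forest, so only steps that change
    the fibre need an argument.\<close>
  let ?Q = "remdups_adj (map P ?A)"
  have t: "t < length Fs" "Suc t < length Fs" using Suc.prems by auto
  have last: "last ?A = Fs ! t" using last_take[OF t(1)] .
  have A: "?A \<noteq> []" using t by auto
  have take: "map P (take (Suc (Suc t)) Fs) = map P ?A @ [P (Fs ! Suc t)]"
    using take_Suc_conv_app_nth[OF t(2)] by simp
  have lastQ: "last ?Q = P (Fs ! t)" using A last by (simp add: last_remdups_adj last_map)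
  have IH: "alg_R_visits E (P F0) ?Q" using Suc t by simp
  have app: "remdups_adj (map P (take (Suc (Suc t)) Fs)) =
    (if P (Fs ! Suc t) = P (Fs ! t) then ?Q else ?Q @ [P (Fs ! Suc t)])"
    using A last unfolding take by (simp add: remdups_adj_append'' last_map)
  show ?case
  proof (cases "P (Fs ! Suc t) = P (Fs ! t)")
    case True
    then show ?thesis using app IH by simp
  next
    case False
    note Ft = forest_nth[OF t(1)]
    obtain j i where j: "new_rotations E ?A j = {(i, Fs ! Suc t)}"
      "\<And>k. k > j \<Longrightarrow> new_rotations E ?A k = {}" using step[OF t(2)] by blast
    then have rot: "(i, Fs ! Suc t) \<in> level_rotations E (Fs ! t) j"
      using new_rotations_iff[of i _ E ?A j] last by auto
    have jn: "j \<noteq> n"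
    proof
      assume "j = n"
      then have "(Fs ! t, Fs ! Suc t) \<in> link" using rot Ft by (auto simp: link_def)
      then show False using link_forest_del False by blast
    qed
    have "new_rotations E ?A n = {}" using j jn n_max level_rotations_sym(4)[OF fin Ft rot] by force
    \<comment> \<open>With no new rotation at \<open>n\<close>, only the backward alternative of
      \<open>incident_neighbour\<close> remains, and it determines the index.\<close>
    then have inc: "a = b" if "a \<in> incident (Fs ! t) n" "b \<in> incident (Fs ! t) n" for a b
      using incident_neighbour[OF t(1) that(1)] incident_neighbour[OF t(1) that(2)] by auto
    have lift: "\<exists>F'. (k, F') \<in> new_rotations E ?A m \<and> P F' = X"
      if X: "(k, X) \<in> new_rotations E ?Q m" for k X m
    proof -
      have X': "(k, X) \<in> level_rotations E (P (Fs ! t)) m" "X \<notin> set ?Q"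
        using X new_rotations_iff lastQ by auto
      obtain F' where F': "(k, F') \<in> level_rotations E (Fs ! t) m" "P F' = X"
        using forest_del_rotation_lift[OF Ft inc X'(1)] by blast
      moreover have "F' \<notin> set ?A" using X'(2) F'(2) by auto
      ultimately show ?thesis using new_rotations_iff last by metis
    qed
    \<comment> \<open>A fibre touched before time \<open>t\<close> has been visited completely by
      \<open>fibre_contiguous\<close>, so entering it again would repeat a forest.\<close>
    have "P (Fs ! Suc t) \<notin> set ?Q"
    proof
      assume "P (Fs ! Suc t) \<in> set ?Q"
      then obtain F where "F \<in> set ?A" "P F = P (Fs ! Suc t)" by auto
      then have "Fs ! Suc t \<in> set ?A" using fibre_contiguous[OF t(2) False] forest_nth[OF t(2)] by blast
      then show False using not_visited_before[OF t(2), of t] by simp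
    qed
    then have "(i, P (Fs ! Suc t)) \<in> new_rotations E ?Q j"
      using new_rotations_iff lastQ forest_del_rotation[OF Ft rot jn False] by simp
    \<comment> \<open>No tie arises: a lifted competitor keeps its edge index and must equal the
      unique choice upstairs.\<close>
    moreover have "new_rotations E ?Q j \<subseteq> {(i, P (Fs ! Suc t))}"
    proof
      fix p assume "p \<in> new_rotations E ?Q j"
      moreover obtain k X where "p = (k, X)" by (cases p)
      ultimately show "p \<in> {(i, P (Fs ! Suc t))}" using lift[of k X j] j(1) by auto
    qed
    ultimately have "new_rotations E ?Q j = {(i, P (Fs ! Suc t))}" by blast
    moreover have "new_rotations E ?Q k = {}" if "k > j" for k
      using lift[of _ _ k] j(2)[OF that] by fast
    ultimately have "\<exists>j i. new_rotations E ?Q j = {(i, P (Fs ! Suc t))} \<and> (\<forall>k>j. new_rotations E ?Q k = {})"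
      by blast
    moreover have "elim_forest (V - {n}) E (last ?Q)" using lastQ forest_del_forest[OF Ft] by simp
    ultimately have "alg_R_next E ?Q = Some (P (Fs ! Suc t))"
      using alg_R_next_eq_Some_iff[of "V - {n}" E ?Q] fin by simp
    then show ?thesis using app False alg_R_visits.visit[OF IH] by simp
  qed
qed

lemma reduced_exhaustive_run:
  "\<exists>F0' Fs'. elim_forest (V - {n}) E F0' \<and> alg_R_visits E F0' Fs' \<and>
     (\<forall>F. elim_forest (V - {n}) E F \<longrightarrow> F \<in> set Fs')"
proof -
  let ?Q = "remdups_adj (map P Fs)"
  have "Fs \<noteq> []" using inv by blast
  then have "alg_R_visits E (P F0) ?Q" using projected_run[of "length Fs - 1"] by simp
  moreover have "F \<in> set ?Q" if F: "elim_forest (V - {n}) E F" for F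
  proof -
    obtain G where "elim_forest V E G" "P G = F" using forest_del_surj[OF F] by blast
    then show ?thesis using all by auto
  qed
  ultimately show ?thesis using forest_del_forest[OF F0] by blast
qed

end

section \<open>Descent to the smaller graph and the final induction\<close>

text \<open>A cycle of length at least four lies in one component, which then has more than three
  vertices; and the two cycle neighbours of a simplicial vertex would be joined by a chord.\<close>

lemma induced_cycle_avoids:
  assumes fin: "finite V" and xs: "induced_cycle V E xs" "length xs \<noteq> 3"
    and small: "small_or_simplicial E V n"
  shows "n \<notin> set xs"
proof
  let ?k = "length xs"
  assume "n \<in> set xs"
  then obtain p where p: "p < ?k" "n = xs ! p" by (auto simp: in_set_conv_nth)
  have k: "?k \<ge> 4" and dist: "distinct xs" and sub: "set xs \<subseteq> V"
    and E: "\<And>a b. a < ?k \<Longrightarrow> b < ?k \<Longrightarrow> {xs ! a, xs ! b} \<in> E \<longleftrightarrow> b = Suc a mod ?k \<or> a = Suc b mod ?k"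
    using xs unfolding induced_cycle_def by auto
  have Suc_mod: "Suc a mod ?k = (if Suc a = ?k then 0 else Suc a)" if "a < ?k" for a
    using that by auto
  show False using small unfolding small_or_simplicial_def
  proof
    assume 3: "card (component E V n) \<le> 3"
    have V: "xs ! a \<in> V" if "a < ?k" for a using that sub by auto
    have from0: "xs ! a \<in> component E V (xs ! 0)" if "a < ?k" for a
      using that
    proof (induction a)
      case (Suc a)
      then have "{xs ! a, xs ! Suc a} \<in> E" using E[of a "Suc a"] Suc_mod[of a] by simp
      then show ?case using Suc component_step[of "xs ! a" E V "xs ! 0" "xs ! Suc a"] V by simp
    qed simp
    then have "component E V n = component E V (xs ! 0)" using p component_eq by metis
    then have "set xs \<subseteq> component E V n" using from0 by (auto simp: in_set_conv_nth)
    moreover have "finite (component E V n)"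
      using component_subset[of n V E] V p fin finite_subset by blast
    ultimately have "card (set xs) \<le> 3" using 3 card_mono[of "component E V n" "set xs"] by linarith
    then show False using k distinct_card[OF dist] by simp
  next
    assume simp: "\<forall>a\<in>V. \<forall>b\<in>V. a \<noteq> n \<longrightarrow> b \<noteq> n \<longrightarrow> a \<noteq> b \<longrightarrow> {n, a} \<in> E \<longrightarrow> {n, b} \<in> E \<longrightarrow> {a, b} \<in> E"
    \<comment> \<open>\<open>s\<close> and \<open>r\<close> are the cyclic successor and predecessor
      of \<open>p\<close>, written without \<open>mod\<close> so that the index cases can be decided
      directly.\<close>
    define s where "s = (if Suc p = ?k then 0 else Suc p)"
    define r where "r = (if p = 0 then ?k - 1 else p - 1)"
    have sr: "s < ?k" "r < ?k" "s \<noteq> p" "r \<noteq> p" "s \<noteq> r" using k p unfolding s_def r_def by (auto split: if_splits)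
    have ne: "xs ! s \<noteq> n" "xs ! r \<noteq> n" "xs ! s \<noteq> xs ! r"
      using sr p dist by (auto simp: nth_eq_iff_index_eq)
    have "{n, xs ! s} \<in> E" "{n, xs ! r} \<in> E"
      unfolding p(2) E[OF p(1) sr(1)] E[OF p(1) sr(2)] Suc_mod[OF p(1)] Suc_mod[OF sr(2)]
      using p(1) by (auto simp: s_def r_def)
    then have "{xs ! s, xs ! r} \<in> E" using simp ne sr sub nth_mem by (metis subsetD)
    then show False unfolding E[OF sr(1,2)] Suc_mod[OF sr(1)] Suc_mod[OF sr(2)]
      using k p(1) by (auto simp: s_def r_def split: if_splits)
  qed
qed

text \<open>Only \<open>V\<close> shrinks in the induction; \<open>E\<close> stays fixed, since
  components, tubings and induced cycles see only edges inside \<open>V\<close>. The start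
  \<open>F0\<close> is arbitrary because the collapsed run begins at its projection.\<close>

lemma no_exhaustive_run:
  assumes "finite V" "\<not> chordal V E" "elim_forest V E F0" "alg_R_visits E F0 Fs"
  shows "\<exists>F. elim_forest V E F \<and> F \<notin> set Fs"
  using assms
proof (induction "card V" arbitrary: V F0 Fs rule: less_induct)
  case less
  show ?case
  proof (rule ccontr)
    assume no: "\<not> ?thesis"
    obtain xs where xs: "induced_cycle V E xs" "length xs \<noteq> 3"
      using less.prems(2) by (auto simp: chordal_def)
    then have "set xs \<subseteq> V" "xs \<noteq> []" by (auto simp: induced_cycle_def)
    then have "V \<noteq> {}" by auto
    then interpret exhaustive_run E V F0 Fs "Max V"
      using less.prems no by unfold_locales auto
    have "Max V \<notin> set xs" using induced_cycle_avoids[OF fin xs small_or_simplicial] .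
    then have "induced_cycle (V - {Max V}) E xs" using xs(1) by (auto simp: induced_cycle_def)
    then have "\<not> chordal (V - {Max V}) E" using xs(2) by (auto simp: chordal_def)
    moreover have "card (V - {Max V}) < card V" using fin n by (rule card_Diff1_less)
    ultimately show False using less.hyps[of "V - {Max V}"] reduced_exhaustive_run fin by blast
  qed
qed

text \<open>Carries an induced cycle along the labelling. Edges must lie in \<open>V\<close> because
  \<open>l\<close> is injective only there, and a non-edge must not acquire the image of an
  edge.\<close>

lemma chordal_image:
  assumes inj: "inj_on l V" and E: "\<And>e. e \<in> E \<Longrightarrow> e \<subseteq> V" and "chordal (l ` V) ((`) l ` E)"
  shows "chordal V E"
  unfolding chordal_def
proof (intro allI impI)
  fix xs assume xs: "induced_cycle V E xs"
  have "{l x, l y} \<in> (`) l ` E \<longleftrightarrow> {x, y} \<in> E" if "x \<in> V" "y \<in> V" for x y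
  proof -
    have "{l x, l y} = l ` {x, y}" by simp
    moreover have "l ` {x, y} \<in> (`) l ` E \<longleftrightarrow> {x, y} \<in> E"
      using inj_on_image_eq_iff[OF inj, of "{x, y}"] that E by blast
    ultimately show ?thesis by simp
  qed
  moreover have "xs ! a \<in> V" if "a < length xs" for a using xs that by (auto simp: induced_cycle_def)
  moreover have "distinct (map l xs)" using xs inj by (auto simp: induced_cycle_def distinct_map intro: inj_on_subset)
  ultimately have "induced_cycle (l ` V) ((`) l ` E) (map l xs)"
    using xs by (auto simp: induced_cycle_def)
  then show "length xs = 3" using assms(3) by (auto simp: chordal_def)
qed

theorem theorem38:
  fixes V :: "'a set" and E :: "'a set set" and n :: nat
    and l :: "'a \<Rightarrow> nat" and F0 :: "nat rel"
  assumes "simple_graph V E"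
    and "\<not> chordal V E"
    and "bij_betw l V {1..n}"
    and "elim_forest {1..n} ((`) l ` E) F0"
  shows "\<exists>Fs. alg_R_terminates_with ((`) l ` E) F0 Fs \<and>
           (\<exists>F. elim_forest {1..n} ((`) l ` E) F \<and> F \<notin> set Fs)"
proof -
  have "\<not> chordal {1..n} ((`) l ` E)"
    using chordal_image[of l V E] assms(1-3) by (auto simp: simple_graph_def bij_betw_def)
  then show ?thesis
    using alg_R_terminates[OF _ assms(4)] no_exhaustive_run[OF _ _ assms(4)]
    by (auto simp: alg_R_terminates_with_def)
qed

end
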